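(* Let $X$ be an abstract state space and suppose $A,B$ satisfy Kato's conditions and that the associated perturbed (Kato) semigroup $(V(t))_{t\ge0}$ is honest. Let $K$ be a positive linear operator in $X$ with domain $D(K)$ such that there is an extension $A_K$ of $(A-K,\ D(A)\cap D(K))$ that generates a substochastic $C_0$-semigroup, and such that $A_K,B$ also satisfy Kato's conditions, with perturbed semigroup $(V_K(t))_{t\ge0}$. If $(D(A)\cap D(K))_+$ is dense in $D(A)_+$ with respect to the graph norm of $A$, then $(V_K(t))_{t\ge0}$ is also honest.
   Context: An abstract state space is a real ordered Banach space $X$ with closed generating positive cone $X_+$ on which the norm is additive: $\|u+v\|=\|u\|+\|v\|$ for $u,v\in X_+$. $\Psi\in X^*$ is the linear functional with $\langle\Psi,u\rangle=\|u\|$ for $u\in X_+$. For a subspace $D$, $D_+=D\cap X_+$; $R(\lambda,A)=(\lambda-A)^{-1}$. A linear operator $K$ is positive if $Ku\in X_+$ for all $u\in D(K)_+$. A bounded operator $T$ is substochastic if it is positive and $\|Tu\|\le\|u\|$ for $u\in X_+$; a semigroup is substochastic if each of its operators is. Kato's conditions on $A,B$ with $D(A)\subseteq D(B)\subseteq X$: (1) $A$ generates a substochastic $C_0$-semigroup; (2) $Bu\ge0$ for $u\in D(A)_+$; (3) $\langle\Psi,(A+B)u\rangle\le0$ for all $u\in D(A)_+$. Here $A+B$ has domain $D(A)$. Kato's Theorem (known): under these conditions there is an extension $G$ of $A+B$ generating a substochastic $C_0$-semigroup $(V(t))_{t\ge0}$ (the perturbed, or Kato, semigroup), with $R(\lambda,G)u=\sum_{k\ge0}R(\lambda,A)(BR(\lambda,A))^ku$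 for $\lambda>0$, $u\in X$; it is the minimal substochastic $C_0$-semigroup whose generator extends $A+B$. Honesty: put $a(u)=-\langle\Psi,Au+Bu\rangle$ for $u\in D(A)$ and define $\bar a:D(G)\to\mathbb R$ by $\bar a(R(\lambda,G)u)=\sum_{k\ge0}a\big(R(\lambda,A)(BR(\lambda,A))^ku\big)$, $u\in X$ (well defined and independent of $\lambda>0$). $(V(t))_{t\ge0}$ is honest if $\|V(t)u\|-\|u\|=-\bar a\big(\int_0^tV(s)u\,ds\big)$ for all $t\ge0$, $u\in X_+$; otherwise it is dishonest. For the pair $A_K,B$ honesty of $(V_K(t))_{t\ge0}$ is defined in the same way with $A_K$ in place of $A$. *)

theory Defs
  imports "HOL-Analysis.Analysis"
begin

text \<open>The positive cone is \<open>{u. 0 \<le> u}\<close>.\<close>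

class abstract_state_space = banach + ordered_real_vector +
  assumes closed_cone: "closed {u. 0 \<le> u}"
    and generating_cone: "\<exists>v w. 0 \<le> v \<and> 0 \<le> w \<and> u = v - w"
    and norm_additive: "0 \<le> u \<Longrightarrow> 0 \<le> v \<Longrightarrow> norm (u + v) = norm u + norm v"

text \<open>
  The functional \<open>\<Psi>\<close>. Uniqueness is immediate because the cone is generating; existence of a
  bounded such functional uses the completeness of the space and the closedness of the cone.
\<close>

definition Psi :: "'a::abstract_state_space \<Rightarrow>\<^sub>L real" where
  "Psi = (THE f. \<forall>u\<ge>0. blinfun_apply f u = norm u)"


text \<open>
  An unbounded operator is a domain together with a function whose values off the domain are
  irrelevant; operators are therefore compared by \<open>op_equal\<close> rather than by \<open>=\<close>.
\<close>

datatype 'a unbounded_op = Op (op_dom: "'a set") (op_app: "'a \<Rightarrow> 'a")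

definition linear_op :: "'a::real_vector unbounded_op \<Rightarrow> bool" where
  "linear_op T \<longleftrightarrow> subspace (op_dom T) \<and>
     (\<forall>u\<in>op_dom T. \<forall>v\<in>op_dom T. op_app T (u + v) = op_app T u + op_app T v) \<and>
     (\<forall>c. \<forall>u\<in>op_dom T. op_app T (c *\<^sub>R u) = c *\<^sub>R op_app T u)"

definition positive_op :: "'a::ordered_real_vector unbounded_op \<Rightarrow> bool" where
  "positive_op T \<longleftrightarrow> (\<forall>u\<in>op_dom T. 0 \<le> u \<longrightarrow> 0 \<le> op_app T u)"

definition op_plus :: "'a::real_vector unbounded_op \<Rightarrow> 'a unbounded_op \<Rightarrow> 'a unbounded_op" where
  "op_plus S T = Op (op_dom S \<inter> op_dom T) (\<lambda>u. op_app S u + op_app T u)"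

definition op_minus :: "'a::real_vector unbounded_op \<Rightarrow> 'a unbounded_op \<Rightarrow> 'a unbounded_op" where
  "op_minus S T = Op (op_dom S \<inter> op_dom T) (\<lambda>u. op_app S u - op_app T u)"

definition op_extends :: "'a unbounded_op \<Rightarrow> 'a unbounded_op \<Rightarrow> bool" where
  "op_extends T S \<longleftrightarrow> op_dom S \<subseteq> op_dom T \<and> (\<forall>u\<in>op_dom S. op_app T u = op_app S u)"

definition op_equal :: "'a unbounded_op \<Rightarrow> 'a unbounded_op \<Rightarrow> bool" where
  "op_equal S T \<longleftrightarrow> op_dom S = op_dom T \<and> (\<forall>u\<in>op_dom S. op_app S u = op_app T u)"

definition graph_norm :: "'a::real_normed_vector unbounded_op \<Rightarrow> 'a \<Rightarrow> real" where
  "graph_norm T u = norm u + norm (op_app T u)"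

text \<open>\<open>R(\<mu>,T) = (\<mu> - T)\<inverse>\<close>; used only for \<open>\<mu>\<close> in the resolvent set of \<open>T\<close>.\<close>

definition resolvent :: "real \<Rightarrow> 'a::real_vector unbounded_op \<Rightarrow> 'a \<Rightarrow> 'a" where
  "resolvent \<mu> T = inv_into (op_dom T) (\<lambda>u. \<mu> *\<^sub>R u - op_app T u)"


text \<open>Semigroups are indexed by \<open>real\<close>, but only their values at times \<open>t \<ge> 0\<close> matter.\<close>

definition C0_semigroup :: "(real \<Rightarrow> 'a::real_normed_vector \<Rightarrow> 'a) \<Rightarrow> bool" where
  "C0_semigroup V \<longleftrightarrow>
     (\<forall>t\<ge>0. bounded_linear (V t)) \<and>
     V 0 = id \<and>
     (\<forall>s\<ge>0. \<forall>t\<ge>0. V (s + t) = V s \<circ> V t) \<and>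
     (\<forall>u. ((\<lambda>t. V t u) \<longlongrightarrow> u) (at_right 0))"

definition generator :: "(real \<Rightarrow> 'a::real_normed_vector \<Rightarrow> 'a) \<Rightarrow> 'a unbounded_op" where
  "generator V = Op
     {u. \<exists>w. ((\<lambda>t. (1 / t) *\<^sub>R (V t u - u)) \<longlongrightarrow> w) (at_right 0)}
     (\<lambda>u. Lim (at_right 0) (\<lambda>t. (1 / t) *\<^sub>R (V t u - u)))"

definition generates :: "'a::real_normed_vector unbounded_op \<Rightarrow> (real \<Rightarrow> 'a \<Rightarrow> 'a) \<Rightarrow> bool" where
  "generates T V \<longleftrightarrow> C0_semigroup V \<and> op_equal T (generator V)"

definition substochastic :: "('a::abstract_state_space \<Rightarrow> 'a) \<Rightarrow> bool" where
  "substochastic T \<longleftrightarrow> bounded_linear T \<and> positive_op (Op UNIV T) \<and>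
     (\<forall>u\<ge>0. norm (T u) \<le> norm u)"

definition substochastic_semigroup :: "(real \<Rightarrow> 'a::abstract_state_space \<Rightarrow> 'a) \<Rightarrow> bool" where
  "substochastic_semigroup V \<longleftrightarrow> C0_semigroup V \<and> (\<forall>t\<ge>0. substochastic (V t))"

definition generates_substochastic :: "'a::abstract_state_space unbounded_op \<Rightarrow> bool" where
  "generates_substochastic T \<longleftrightarrow> (\<exists>S. substochastic_semigroup S \<and> generates T S)"


definition kato_conditions ::
    "'a::abstract_state_space unbounded_op \<Rightarrow> 'a unbounded_op \<Rightarrow> bool" where
  "kato_conditions A B \<longleftrightarrow>
     linear_op A \<and> linear_op B \<and> op_dom A \<subseteq> op_dom B \<and>
     generates_substochastic A \<and>
     (\<forall>u\<in>op_dom A. 0 \<le> u \<longrightarrow> 0 \<le> op_app B u) \<and>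
     (\<forall>u\<in>op_dom A. 0 \<le> u \<longrightarrow> blinfun_apply Psi (op_app (op_plus A B) u) \<le> 0)"

text \<open>\<open>kato_term A B \<mu> k u\<close> is \<open>R(\<mu>,A) (B R(\<mu>,A))\<^sup>k u\<close>.\<close>

definition kato_term ::
    "'a::real_vector unbounded_op \<Rightarrow> 'a unbounded_op \<Rightarrow> real \<Rightarrow> nat \<Rightarrow> 'a \<Rightarrow> 'a" where
  "kato_term A B \<mu> k u = resolvent \<mu> A (((\<lambda>v. op_app B (resolvent \<mu> A v)) ^^ k) u)"

text \<open>
  The perturbed semigroup given by Kato's theorem. It is determined by \<open>A\<close> and \<open>B\<close>, because the
  resolvent of its generator is prescribed by the series.
\<close>

definition kato_semigroup ::
    "'a::abstract_state_space unbounded_op \<Rightarrow> 'a unbounded_op \<Rightarrow> (real \<Rightarrow> 'a \<Rightarrow> 'a) \<Rightarrow> bool" where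
  "kato_semigroup A B V \<longleftrightarrow>
     substochastic_semigroup V \<and>
     op_extends (generator V) (op_plus A B) \<and>
     (\<forall>\<mu>>0. \<forall>u. (\<lambda>k. kato_term A B \<mu> k u) sums resolvent \<mu> (generator V) u)"

definition a_fun ::
    "'a::abstract_state_space unbounded_op \<Rightarrow> 'a unbounded_op \<Rightarrow> 'a \<Rightarrow> real" where
  "a_fun A B u = - blinfun_apply Psi (op_app A u + op_app B u)"

text \<open>
  The value at \<open>x \<in> D(G)\<close> is the common sum, for all \<open>\<mu> > 0\<close>, of the series at the unique \<open>u\<close>
  with \<open>x = R(\<mu>,G) u\<close>.
\<close>

definition a_bar ::
    "'a::abstract_state_space unbounded_op \<Rightarrow> 'a unbounded_op \<Rightarrow> 'a unbounded_op \<Rightarrow> 'a \<Rightarrow> real" where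
  "a_bar A B G x = (THE r. \<forall>\<mu>>0. \<forall>u. resolvent \<mu> G u = x \<longrightarrow>
     (\<lambda>k. a_fun A B (kato_term A B \<mu> k u)) sums r)"

definition honest ::
    "'a::abstract_state_space unbounded_op \<Rightarrow> 'a unbounded_op \<Rightarrow> (real \<Rightarrow> 'a \<Rightarrow> 'a) \<Rightarrow> bool" where
  "honest A B V \<longleftrightarrow> (\<forall>t\<ge>0. \<forall>u\<ge>0.
     norm (V t u) - norm u = - a_bar A B (generator V) (integral {0..t} (\<lambda>s. V s u)))"

end

theory Submission
  imports Defs
begin

text \<open>
  Write \<open>R = R(1,A)\<close> and \<open>R\<^sub>K = R(1,A\<^sub>K)\<close>. Since \<open>a\<close> telescopes along the Kato series,
  \<open>\<langle>\<Psi>,Gx\<rangle> + a_bar x\<close> equals, for \<open>x = R(1,G)u\<close>, minus the limit \<open>\<delta>(u)\<close> of \<open>\<langle>\<Psi>,(BR)\<^sup>n u\<rangle>\<close>.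
  Honesty says that \<open>\<delta>\<close> vanishes at all \<open>(1 - G)x\<close> with \<open>x\<close> the integral of an orbit from
  \<open>0\<close> to \<open>t\<close>; this forces \<open>\<delta>(V(t)u) \<ge> (1 + t) \<delta>(u)\<close> while \<open>\<delta>(V(t)u) \<le> \<parallel>u\<parallel>\<close>, hence \<open>\<delta> = 0\<close>.
  So honesty is equivalent to the strong convergence \<open>(BR)\<^sup>n \<rightarrow> 0\<close>.
  For positive \<open>v\<close> in \<open>D(A) \<inter> D(K)\<close> and \<open>f = (1 - A)v\<close> one has \<open>BRf - BR\<^sub>Kf = BR\<^sub>KKv \<ge> 0\<close>.
  By density \<open>BR\<^sub>K \<le> BR\<close> on the cone, hence \<open>(BR\<^sub>K)\<^sup>n \<le> (BR)\<^sup>n\<close>.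
\<close>

subsection \<open>The norm and the cone\<close>

lemma norm_mono_cone:
  fixes u v :: "'a::abstract_state_space"
  assumes "0 \<le> u" "u \<le> v"
  shows "norm u \<le> norm v"
  using norm_additive[of u "v - u"] assms by simp

lemma cone_limit:
  fixes l :: "'a::abstract_state_space"
  assumes "f \<longlonglongrightarrow> l" "\<And>n. 0 \<le> f n"
  shows "0 \<le> l"
  using closed_sequentially[OF closed_cone, of f l] assms by auto

lemma cone_limit_le:
  fixes l :: "'a::abstract_state_space"
  assumes "f \<longlonglongrightarrow> l" "g \<longlonglongrightarrow> m" "\<And>n. f n \<le> g n"
  shows "l \<le> m"
  using cone_limit[OF tendsto_diff[OF assms(2,1)]] assms(3) by simp

lemma cone_sums:
  fixes l :: "'a::abstract_state_space"
  assumes "f sums l" "\<And>n. 0 \<le> f n"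
  shows "0 \<le> l"
  using cone_limit[OF assms(1)[unfolded sums_def]] assms(2) by (simp add: sum_nonneg)

lemma ex_Psi: "\<exists>f :: 'a::abstract_state_space \<Rightarrow>\<^sub>L real. \<forall>u\<ge>0. blinfun_apply f u = norm u"
proof -
  have "\<forall>u::'a. \<exists>p. 0 \<le> fst p \<and> 0 \<le> snd p \<and> u = fst p - snd p"
    using generating_cone by fastforce
  then obtain p :: "'a \<Rightarrow> 'a \<times> 'a"
    where p: "\<And>u. 0 \<le> fst (p u)" "\<And>u. 0 \<le> snd (p u)" "\<And>u. u = fst (p u) - snd (p u)"
    by metis
  define f where "f u = norm (fst (p u)) - norm (snd (p u))" for u
  have f: "f u = norm v - norm w" if "0 \<le> v" "0 \<le> w" "u = v - w" for u v w
  proof -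
    have "fst (p u) + w = v + snd (p u)"
      using p(3)[of u] that(3) by (metis add.commute diff_add_eq diff_eq_eq)
    then have "norm (fst (p u)) + norm w = norm v + norm (snd (p u))"
      using p(1,2) that norm_additive by metis
    then show ?thesis by (simp add: f_def)
  qed
  have add: "f (u + v) = f u + f v" for u v
  proof -
    have "f (u + v) = norm (fst (p u) + fst (p v)) - norm (snd (p u) + snd (p v))"
    proof (rule f)
      show "u + v = (fst (p u) + fst (p v)) - (snd (p u) + snd (p v))"
        using p(3)[of u] p(3)[of v] by (metis add_diff_add)
    qed (use p(1,2) in auto)
    then show ?thesis using p(1,2) by (simp add: norm_additive f_def)
  qed
  have neg: "f (- u) = - f u" for u
    using f[of "snd (p u)" "fst (p u)" "- u"] p(1,2)[of u] p(3)[of u] unfolding f_def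
    by (metis minus_diff_eq)
  have scale_pos: "f (c *\<^sub>R u) = c * f u" if "0 \<le> c" for c u
  proof -
    have "f (c *\<^sub>R u) = norm (c *\<^sub>R fst (p u)) - norm (c *\<^sub>R snd (p u))"
      using p(1,2)[of u] p(3)[of u] that
      by (intro f) (auto simp: scaleR_right_diff_distrib[symmetric] scaleR_nonneg_nonneg)
    then show ?thesis using that by (simp add: f_def algebra_simps)
  qed
  have scale: "f (c *\<^sub>R u) = c * f u" for c u
    using scale_pos[of c u] scale_pos[of "- c" u] neg[of "c *\<^sub>R u"]
    by (cases "0 \<le> c") (auto simp: neg)
  have bound: "f u \<le> norm u" for u
    using norm_triangle_ineq2[of "fst (p u)" "snd (p u)"] p(3)[of u] by (simp add: f_def)
  have "bounded_linear f"
  proof (rule bounded_linear_intro[where K = 1])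
    show "norm (f u) \<le> norm u * 1" for u
      using bound[of u] bound[of "- u"] by (simp add: neg)
  qed (simp_all add: add scale)
  then have "blinfun_apply (Blinfun f) = f" by (rule bounded_linear_Blinfun_apply)
  then have "\<forall>u\<ge>0. blinfun_apply (Blinfun f) u = norm u"
    using f[of _ 0] by auto
  then show ?thesis by blast
qed

lemma Psi_cone:
  fixes u :: "'a::abstract_state_space"
  assumes "0 \<le> u"
  shows "blinfun_apply Psi u = norm u"
proof -
  obtain f :: "'a \<Rightarrow>\<^sub>L real" where f: "\<forall>u\<ge>0. blinfun_apply f u = norm u"
    using ex_Psi by blast
  have "g = f" if "\<forall>u\<ge>0. blinfun_apply g u = norm u" for g
  proof (rule blinfun_eqI)
    fix u :: 'a
    obtain v w where "0 \<le> v" "0 \<le> w" "u = v - w" using generating_cone by blast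
    then show "blinfun_apply g u = blinfun_apply f u" using f that by (simp add: blinfun.diff_right)
  qed
  with f have "Psi = f" unfolding Psi_def by (rule the_equality)
  then show ?thesis using f assms by simp
qed

lemma approximate_decomposition:
  obtains C where "0 < C" "\<And>(u::'a::abstract_state_space) e. 0 < e \<Longrightarrow>
    \<exists>v w. 0 \<le> v \<and> 0 \<le> w \<and> norm v + norm w \<le> C * norm u \<and> norm (u - (v - w)) < e"
proof -
  define S :: "real \<Rightarrow> 'a set"
    where "S r = {v - w | v w. 0 \<le> v \<and> 0 \<le> w \<and> norm v + norm w \<le> r}" for r
  have "\<exists>n. u \<in> S (real n)" for u
  proof -
    obtain v w where "0 \<le> v" "0 \<le> w" "u = v - w" using generating_cone by blast
    then show ?thesis unfolding S_def using real_arch_simple[of "norm v + norm w"] by blast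
  qed
  then have cover: "(\<Union>n. closure (S (real n))) = UNIV"
    by (auto intro: subsetD[OF closure_subset])
  have "\<exists>n. interior (closure (S (real n))) \<noteq> {}"
  proof (rule ccontr)
    assume "\<not> ?thesis"
    then have "Met_TC.mtopology interior_of (\<Union>n. closure (S (real n))) = {}"
      by (intro Met_TC.metric_Baire_category_alt) (auto simp: complete_UNIV)
    then show False using cover by simp
  qed
  then obtain n x where "x \<in> interior (closure (S (real n)))" by blast
  then obtain d where d: "0 < d" "ball x d \<subseteq> closure (S (real n))"
    by (meson mem_interior)
  have uminus: "- y \<in> S r" if "y \<in> S r" for y r
  proof -
    from that obtain v w where "0 \<le> v" "0 \<le> w" "norm v + norm w \<le> r" "y = v - w"
      unfolding S_def by blast
    then have "- y = w - v" "norm w + norm v \<le> r" by auto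
    then show ?thesis unfolding S_def using \<open>0 \<le> v\<close> \<open>0 \<le> w\<close> by blast
  qed
  have approx: "\<exists>v w. 0 \<le> v \<and> 0 \<le> w \<and> norm v + norm w \<le> n \<and> norm (u - (v - w)) < e"
    if u: "norm u < d" and e: "0 < e" for u :: 'a and e
  proof -
    text \<open>\<open>u\<close> is the midpoint of \<open>x + u\<close> and \<open>- (x - u)\<close>, and \<open>S (real n)\<close> is symmetric and convex.\<close>
    have "x + u \<in> closure (S (real n))" "x - u \<in> closure (S (real n))"
      using d(2) u by (auto simp: subset_iff dist_norm)
    then obtain y z where y: "y \<in> S (real n)" "dist y (x + u) < e"
      and z: "z \<in> S (real n)" "dist z (x - u) < e"
      using e unfolding closure_approachable by meson
    obtain v w where vw: "0 \<le> v" "0 \<le> w" "norm v + norm w \<le> n" "y = v - w"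
      using y unfolding S_def by blast
    obtain v' w' where vw': "0 \<le> v'" "0 \<le> w'" "norm v' + norm w' \<le> n" "- z = v' - w'"
      using uminus[OF z(1)] unfolding S_def by blast
    have "u - ((1/2) *\<^sub>R (v + v') - (1/2) *\<^sub>R (w + w')) = (1/2) *\<^sub>R ((x + u - y) - (x - u - z))"
    proof -
      have "(1/2) *\<^sub>R (v + v') - (1/2) *\<^sub>R (w + w') = (1/2) *\<^sub>R ((v - w) + (v' - w'))"
        by (simp add: algebra_simps)
      also have "\<dots> = (1/2) *\<^sub>R (y - z)" using vw(4) vw'(4) by simp
      finally have "u - ((1/2) *\<^sub>R (v + v') - (1/2) *\<^sub>R (w + w')) = u - (1/2) *\<^sub>R (y - z)" by simp
      also have "\<dots> = (1/2) *\<^sub>R (u + u - y + z)"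
        by (simp add: algebra_simps flip: scaleR_add_left)
      finally show ?thesis by (simp add: algebra_simps)
    qed
    then have "norm (u - ((1/2) *\<^sub>R (v + v') - (1/2) *\<^sub>R (w + w')))
        \<le> (1/2) * (norm (x + u - y) + norm (x - u - z))"
      using norm_triangle_ineq4[of "x + u - y" "x - u - z"] by simp
    also have "\<dots> < e" using y(2) z(2) by (simp add: dist_norm norm_minus_commute)
    finally have "norm (u - ((1/2) *\<^sub>R (v + v') - (1/2) *\<^sub>R (w + w'))) < e" .
    moreover have "norm ((1/2) *\<^sub>R (v + v')) + norm ((1/2) *\<^sub>R (w + w')) \<le> n"
      using norm_triangle_ineq[of v v'] norm_triangle_ineq[of w w'] vw(3) vw'(3) by simp
    ultimately show ?thesis
      using vw(1,2) vw'(1,2)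
      by (intro exI[of _ "(1/2) *\<^sub>R (v + v')"] exI[of _ "(1/2) *\<^sub>R (w + w')"])
        (auto intro!: scaleR_nonneg_nonneg)
  qed
  define C where "C = 2 * (real n + 1) / d"
  have C: "0 < C" using d(1) by (simp add: C_def)
  moreover have "\<exists>v w. 0 \<le> v \<and> 0 \<le> w \<and> norm v + norm w \<le> C * norm u \<and> norm (u - (v - w)) < e"
    if "0 < e" for u :: 'a and e
  proof (cases "u = 0")
    case True
    then show ?thesis using that by (intro exI[of _ 0]) auto
  next
    case False
    define t where "t = 2 * norm u / d"
    have t: "0 < t" using False d(1) by (simp add: t_def)
    have "norm ((1/t) *\<^sub>R u) < d" using False d(1) by (simp add: t_def field_simps)
    moreover have "0 < e / t" using that t by simp
    ultimately obtain v w where vw: "0 \<le> v" "0 \<le> w" "norm v + norm w \<le> n"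
      "norm ((1/t) *\<^sub>R u - (v - w)) < e / t"
      using approx by blast
    have "u - (t *\<^sub>R v - t *\<^sub>R w) = t *\<^sub>R ((1/t) *\<^sub>R u - (v - w))"
      using t by (simp add: algebra_simps)
    then have "norm (u - (t *\<^sub>R v - t *\<^sub>R w)) < e"
      using vw(4) t by (simp del: scaleR_right_diff_distrib add: pos_less_divide_eq mult.commute)
    moreover have "norm (t *\<^sub>R v) + norm (t *\<^sub>R w) \<le> C * norm u"
    proof -
      have "norm (t *\<^sub>R v) + norm (t *\<^sub>R w) = t * (norm v + norm w)"
        using t by (simp add: algebra_simps)
      also have "\<dots> \<le> t * (real n + 1)" using vw(3) t by (intro mult_left_mono) auto
      finally show ?thesis by (simp add: t_def C_def mult_ac)
    qed
    ultimately show ?thesis using vw(1,2) t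
      by (intro exI[of _ "t *\<^sub>R v"] exI[of _ "t *\<^sub>R w"]) (auto intro!: scaleR_nonneg_nonneg)
  qed
  ultimately show ?thesis using that by blast
qed

lemma bounded_decomposition:
  obtains M where "0 < M" "\<And>u::'a::abstract_state_space.
    \<exists>v w. 0 \<le> v \<and> 0 \<le> w \<and> u = v - w \<and> norm v + norm w \<le> M * norm u"
proof -
  obtain C where C: "0 < C" "\<And>(u::'a) e. 0 < e \<Longrightarrow>
    \<exists>v w. 0 \<le> v \<and> 0 \<le> w \<and> norm v + norm w \<le> C * norm u \<and> norm (u - (v - w)) < e"
    by (rule approximate_decomposition) blast
  have "\<forall>u::'a. \<exists>p. 0 \<le> fst p \<and> 0 \<le> snd p \<and> norm (fst p) + norm (snd p) \<le> C * norm u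
      \<and> norm (u - (fst p - snd p)) \<le> norm u / 2"
  proof
    fix u :: 'a
    show "\<exists>p. 0 \<le> fst p \<and> 0 \<le> snd p \<and> norm (fst p) + norm (snd p) \<le> C * norm u
      \<and> norm (u - (fst p - snd p)) \<le> norm u / 2"
    proof (cases "u = 0")
      case True
      then show ?thesis by (intro exI[of _ "(0, 0)"]) auto
    next
      case False
      then show ?thesis using C(2)[of "norm u / 2" u] by fastforce
    qed
  qed
  then obtain p :: "'a \<Rightarrow> 'a \<times> 'a"
    where p: "\<And>u. 0 \<le> fst (p u)" "\<And>u. 0 \<le> snd (p u)"
      "\<And>u. norm (fst (p u)) + norm (snd (p u)) \<le> C * norm u"
      "\<And>u. norm (u - (fst (p u) - snd (p u))) \<le> norm u / 2"
    by metis
  have "\<exists>v w. 0 \<le> v \<and> 0 \<le> w \<and> u = v - w \<and> norm v + norm w \<le> (2 * C) * norm u" for u :: 'a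
  proof -
    define r where "r k = ((\<lambda>x. x - (fst (p x) - snd (p x))) ^^ k) u" for k
    have r: "norm (r k) \<le> (1/2) ^ k * norm u" for k
    proof (induction k)
      case (Suc k)
      have "norm (r (Suc k)) \<le> norm (r k) / 2" using p(4) by (simp add: r_def)
      then show ?case using Suc by simp
    qed (simp add: r_def)
    have rS: "r (Suc k) = r k - (fst (p (r k)) - snd (p (r k)))" for k by (simp add: r_def)
    have nn: "norm (fst (p (r k))) + norm (snd (p (r k))) \<le> (1/2) ^ k * (C * norm u)" for k
      using order_trans[OF p(3) mult_left_mono[OF r]] C(1) by (simp add: mult_ac)
    have geo: "(\<lambda>k. (1/2) ^ k * (C * norm u)) sums (2 * (C * norm u))"
      using sums_mult2[OF geometric_sums[of "1/2::real"], of "C * norm u"] by simp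
    have n1: "norm (norm (fst (p (r k)))) \<le> (1/2) ^ k * (C * norm u)"
      and n2: "norm (norm (snd (p (r k)))) \<le> (1/2) ^ k * (C * norm u)" for k
      using nn[of k] norm_ge_zero[of "fst (p (r k))"] norm_ge_zero[of "snd (p (r k))"]
      unfolding real_norm_def abs_norm_cancel by linarith+
    have s1: "summable (\<lambda>k. norm (fst (p (r k))))"
      by (rule summable_comparison_test[OF _ sums_summable[OF geo]]) (use n1 in blast)
    have s2: "summable (\<lambda>k. norm (snd (p (r k))))"
      by (rule summable_comparison_test[OF _ sums_summable[OF geo]]) (use n2 in blast)
    define v where "v = (\<Sum>k. fst (p (r k)))"
    define w where "w = (\<Sum>k. snd (p (r k)))"
    have v: "(\<lambda>k. fst (p (r k))) sums v" unfolding v_def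
      by (rule summable_sums[OF summable_norm_cancel[OF s1]])
    have w: "(\<lambda>k. snd (p (r k))) sums w" unfolding w_def
      by (rule summable_sums[OF summable_norm_cancel[OF s2]])
    have "0 \<le> v" "0 \<le> w"
      using cone_sums[OF v] cone_sums[OF w] p(1,2) by auto
    moreover have "u = v - w"
    proof -
      have "r \<longlonglongrightarrow> 0"
      proof (rule Lim_null_comparison)
        show "\<forall>\<^sub>F k in sequentially. norm (r k) \<le> (1/2) ^ k * norm u" using r by simp
        have "(\<lambda>k. (1/2) ^ k * norm u) \<longlonglongrightarrow> 0 * norm u"
          by (intro tendsto_intros LIMSEQ_realpow_zero) auto
        then show "(\<lambda>k. (1/2) ^ k * norm u) \<longlonglongrightarrow> 0" by simp
      qed
      then have "(\<lambda>k. r k - r (Suc k)) sums (r 0 - 0)" by (rule telescope_sums')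
      moreover have "(\<lambda>k. r k - r (Suc k)) sums (v - w)"
        unfolding rS using sums_diff[OF v w] by simp
      ultimately have "r 0 - 0 = v - w" by (rule sums_unique2)
      then show ?thesis by (simp add: r_def)
    qed
    moreover have "norm v + norm w \<le> 2 * C * norm u"
    proof -
      have "norm v + norm w \<le> (\<Sum>k. norm (fst (p (r k)))) + (\<Sum>k. norm (snd (p (r k))))"
        unfolding v_def w_def using s1 s2 by (intro add_mono summable_norm)
      also have "\<dots> = (\<Sum>k. norm (fst (p (r k))) + norm (snd (p (r k))))"
        using s1 s2 by (rule suminf_add)
      also have "\<dots> \<le> 2 * (C * norm u)"
        using suminf_le[OF nn summable_add[OF s1 s2] sums_summable[OF geo]] sums_unique[OF geo] by simp
      finally show ?thesis by simp
    qed
    ultimately show ?thesis by blast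
  qed
  then show ?thesis using C(1) that[of "2 * C"] by simp
qed

lemma bounded_linear_of_cone:
  fixes T :: "'a::abstract_state_space \<Rightarrow> 'b::real_normed_vector"
  assumes "linear T" "\<And>u. 0 \<le> u \<Longrightarrow> norm (T u) \<le> c * norm u"
  shows "bounded_linear T"
proof -
  obtain M where M: "0 < M" "\<And>u::'a.
    \<exists>v w. 0 \<le> v \<and> 0 \<le> w \<and> u = v - w \<and> norm v + norm w \<le> M * norm u"
    by (rule bounded_decomposition) blast
  have "norm (T u) \<le> norm u * (\<bar>c\<bar> * M)" for u
  proof -
    obtain v w where vw: "0 \<le> v" "0 \<le> w" "u = v - w" "norm v + norm w \<le> M * norm u"
      using M(2) by blast
    have "norm (T u) \<le> norm (T v) + norm (T w)"
      using vw(3) norm_triangle_ineq4 by (simp add: linear_diff[OF assms(1)])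
    also have "\<dots> \<le> \<bar>c\<bar> * (norm v + norm w)"
    proof -
      have "norm (T v) \<le> \<bar>c\<bar> * norm v" "norm (T w) \<le> \<bar>c\<bar> * norm w"
        using assms(2)[OF vw(1)] assms(2)[OF vw(2)] mult_right_mono[OF abs_ge_self[of c] norm_ge_zero]
        by (blast intro: order_trans)+
      then show ?thesis by (simp add: distrib_left)
    qed
    also have "\<dots> \<le> \<bar>c\<bar> * (M * norm u)" using vw(4) by (intro mult_left_mono) auto
    finally show ?thesis by (simp add: mult_ac)
  qed
  then show ?thesis
    using assms(1) by (intro bounded_linear_intro) (auto simp: linear_add linear_scale)
qed

subsection \<open>Resolvents of substochastic generators\<close>

lemma integral_cone:
  fixes f :: "real \<Rightarrow> 'a::abstract_state_space"
  assumes "f integrable_on {a..b}" "\<And>x. x \<in> {a..b} \<Longrightarrow> 0 \<le> f x"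
  shows "0 \<le> integral {a..b} f"
proof -
  have "integral {a..b} f \<in> closure {u. 0 \<le> u}"
    unfolding closure_approachable
  proof (intro allI impI)
    fix e :: real assume "0 < e"
    then obtain g where g: "gauge g" "\<And>p. p tagged_division_of {a..b} \<Longrightarrow> g fine p \<Longrightarrow>
        norm ((\<Sum>(x,k)\<in>p. measure lborel k *\<^sub>R f x) - integral {a..b} f) < e"
      using integrable_integral[OF assms(1), unfolded has_integral_real, rule_format, OF \<open>0 < e\<close>]
      by auto
    obtain p where p: "p tagged_division_of {a..b}" "g fine p"
      using fine_division_exists_real[OF g(1)] by blast
    have "0 \<le> f x" if "(x, k) \<in> p" for x k
      using tagged_division_ofD(2,3)[OF p(1) that] assms(2) by blast
    then have "0 \<le> (\<Sum>(x,k)\<in>p. measure lborel k *\<^sub>R f x)"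
      by (intro sum_nonneg) (auto intro!: scaleR_nonneg_nonneg)
    then show "\<exists>y\<in>{u. 0 \<le> u}. dist y (integral {a..b} f) < e"
      using g(2)[OF p] by (auto simp: dist_norm)
  qed
  then show ?thesis unfolding closure_closed[OF closed_cone] by simp
qed

locale bounded_C0_semigroup =
  fixes W :: "real \<Rightarrow> 'a::banach \<Rightarrow> 'a" and M :: real
  assumes C0: "C0_semigroup W"
    and M_pos: "0 < M"
    and bound: "\<And>t u. 0 \<le> t \<Longrightarrow> norm (W t u) \<le> M * norm u"
begin

lemma bounded_linear_W: "0 \<le> t \<Longrightarrow> bounded_linear (W t)"
  using C0 by (simp add: C0_semigroup_def)

lemmas W_linear = bounded_linear.linear[OF bounded_linear_W]

lemma W_0 [simp]: "W 0 u = u"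
  using C0 by (simp add: C0_semigroup_def)

lemma W_add: "0 \<le> s \<Longrightarrow> 0 \<le> t \<Longrightarrow> W (s + t) u = W s (W t u)"
  using C0 by (simp add: C0_semigroup_def)

lemma W_commute: "0 \<le> s \<Longrightarrow> 0 \<le> t \<Longrightarrow> W s (W t u) = W t (W s u)"
  by (metis W_add add.commute)

lemma W_tendsto: "((\<lambda>t. W t u) \<longlongrightarrow> u) (at_right 0)"
  using C0 by (simp add: C0_semigroup_def)

lemma continuous_on_orbit: "continuous_on {0..} (\<lambda>t. W t u)"
  unfolding continuous_on_iff
proof (intro ballI allI impI)
  fix s e :: real assume s: "s \<in> {0..}" and e: "0 < e"
  obtain d where d: "0 < d" "\<And>h. 0 < h \<Longrightarrow> h < d \<Longrightarrow> dist (W h u) u < e / M"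
    using tendstoD[OF W_tendsto, of "e / M" u] e M_pos unfolding eventually_at_right_field by auto
  have *: "dist (W t' u) (W t u) < e" if "0 \<le> t" "t \<le> t'" "t' - t < d" for t t'
  proof (cases "t = t'")
    case False
    have "W t' u - W t u = W t (W (t' - t) u - u)"
      using W_add[of t "t' - t" u] that by (simp add: linear_diff[OF W_linear])
    then have "dist (W t' u) (W t u) \<le> M * dist (W (t' - t) u) u"
      using bound[OF that(1)] by (simp add: dist_norm)
    also have "\<dots> < M * (e / M)"
      using d(2)[of "t' - t"] that False M_pos by (intro mult_strict_left_mono) auto
    finally show ?thesis using M_pos by simp
  qed (use e in simp)
  show "\<exists>d>0. \<forall>t\<in>{0..}. dist t s < d \<longrightarrow> dist (W t u) (W s u) < e"
  proof (intro exI[of _ d] conjI ballI impI d(1))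
    fix t assume t: "t \<in> {0..}" "dist t s < d"
    then show "dist (W t u) (W s u) < e"
      using *[of s t] *[of t s] s by (cases "s \<le> t") (auto simp: dist_real_def dist_commute)
  qed
qed

lemma integrable_orbit: "0 \<le> a \<Longrightarrow> (\<lambda>s. W s u) integrable_on {a..b}"
  by (intro integrable_continuous_interval continuous_on_subset[OF continuous_on_orbit]) auto

definition orbit_int :: "real \<Rightarrow> 'a \<Rightarrow> 'a" where "orbit_int t u = integral {0..t} (\<lambda>s. W s u)"

lemma orbit_int_add: "orbit_int t (u + v) = orbit_int t u + orbit_int t v"
proof -
  have "orbit_int t (u + v) = integral {0..t} (\<lambda>s. W s u + W s v)"
    unfolding orbit_int_def by (intro integral_cong) (auto simp: linear_add[OF W_linear])
  then show ?thesis by (simp add: orbit_int_def integral_add integrable_orbit)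
qed

lemma orbit_int_scaleR: "orbit_int t (c *\<^sub>R u) = c *\<^sub>R orbit_int t u"
proof -
  have "orbit_int t (c *\<^sub>R u) = integral {0..t} (\<lambda>s. c *\<^sub>R W s u)"
    unfolding orbit_int_def by (intro integral_cong) (auto simp: linear_scale[OF W_linear])
  then show ?thesis by (simp add: orbit_int_def)
qed

lemma bounded_linear_orbit_int:
  assumes "0 \<le> t"
  shows "bounded_linear (orbit_int t)"
proof (rule bounded_linear_intro[where K = "M * t"])
  fix u
  have "norm (integral {0..t} (\<lambda>s. W s u)) \<le> (M * norm u) * (t - 0)"
    using assms bound by (intro integral_bound continuous_on_subset[OF continuous_on_orbit]) auto
  then show "norm (orbit_int t u) \<le> norm u * (M * t)" by (simp add: orbit_int_def mult_ac)
qed (simp_all add: orbit_int_add orbit_int_scaleR)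

lemmas orbit_int_linear = bounded_linear.linear[OF bounded_linear_orbit_int]

lemma W_orbit_int:
  assumes "0 \<le> h" "0 \<le> t"
  shows "W h (orbit_int t u) = orbit_int t (W h u)"
proof -
  have "W h (orbit_int t u) = integral {0..t} (W h \<circ> (\<lambda>s. W s u))"
    unfolding orbit_int_def using assms
    by (intro integral_linear[symmetric] integrable_orbit bounded_linear_W) auto
  also have "\<dots> = orbit_int t (W h u)"
    unfolding orbit_int_def using assms by (intro integral_cong) (auto simp: W_commute)
  finally show ?thesis .
qed

lemma orbit_int_shift:
  assumes "0 \<le> h" "0 \<le> t"
  shows "orbit_int t (W h u) = orbit_int (t + h) u - orbit_int h u"
proof -
  have "orbit_int t (W h u) = integral {0..t} ((\<lambda>s. W s u) \<circ> (+) h)"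
    unfolding orbit_int_def using assms by (intro integral_cong) (auto simp: W_add[symmetric] add.commute)
  also have "\<dots> = integral {h..t + h} (\<lambda>s. W s u)"
    by (simp add: integral_shift_Icc_real)
  also have "\<dots> = orbit_int (t + h) u - orbit_int h u"
    using Henstock_Kurzweil_Integration.integral_combine[of 0 h "t + h" "\<lambda>s. W s u"] assms
    by (simp add: orbit_int_def integrable_orbit algebra_simps)
  finally show ?thesis .
qed

lemma orbit_int_deriv:
  assumes "0 \<le> t"
  shows "((\<lambda>h. (1 / h) *\<^sub>R (orbit_int (t + h) u - orbit_int t u)) \<longlongrightarrow> W t u) (at_right 0)"
proof -
  have "((\<lambda>x. orbit_int x u) has_vector_derivative W t u) (at t within {0..t + 1})"
    unfolding orbit_int_def using assms
    by (intro integral_has_vector_derivative continuous_on_subset[OF continuous_on_orbit]) auto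
  then have "((\<lambda>x. orbit_int x u) has_vector_derivative W t u) (at t within {t..t + 1})"
    by (rule has_vector_derivative_within_subset) (use assms in auto)
  then have "((\<lambda>x. norm (orbit_int x u - orbit_int t u - (x - t) *\<^sub>R W t u) / norm (x - t)) \<longlongrightarrow> 0)
      (at_right t)"
    by (simp add: has_vector_derivative_def has_derivative_iff_norm at_within_Icc_at_right)
  then have "((\<lambda>x. norm ((1 / (x - t)) *\<^sub>R (orbit_int x u - orbit_int t u) - W t u)) \<longlongrightarrow> 0)
      (at_right t)"
  proof (rule Lim_transform_eventually)
    show "\<forall>\<^sub>F x in at_right t. norm (orbit_int x u - orbit_int t u - (x - t) *\<^sub>R W t u) / norm (x - t)
        = norm ((1 / (x - t)) *\<^sub>R (orbit_int x u - orbit_int t u) - W t u)"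
      using eventually_at_right_less
    proof (rule eventually_mono)
      fix x assume "t < x"
      then have "(1 / (x - t)) *\<^sub>R (orbit_int x u - orbit_int t u) - W t u
          = (1 / (x - t)) *\<^sub>R (orbit_int x u - orbit_int t u - (x - t) *\<^sub>R W t u)"
        by (simp add: scaleR_right_diff_distrib)
      then show "norm (orbit_int x u - orbit_int t u - (x - t) *\<^sub>R W t u) / norm (x - t)
        = norm ((1 / (x - t)) *\<^sub>R (orbit_int x u - orbit_int t u) - W t u)"
        using \<open>t < x\<close> by simp
    qed
  qed
  then have "((\<lambda>x. (1 / (x - t)) *\<^sub>R (orbit_int x u - orbit_int t u)) \<longlongrightarrow> W t u) (at_right t)"
    by (rule LIM_zero_cancel[OF tendsto_norm_zero_cancel])
  then show ?thesis
    unfolding at_right_to_0[of t] filterlim_filtermap by (simp add: add.commute)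
qed

lemma orbit_int_generator:
  assumes "0 \<le> t"
  shows "((\<lambda>h. (1 / h) *\<^sub>R (W h (orbit_int t u) - orbit_int t u)) \<longlongrightarrow> W t u - u) (at_right 0)"
proof -
  have "((\<lambda>h. (1 / h) *\<^sub>R (orbit_int (t + h) u - orbit_int t u) - (1 / h) *\<^sub>R (orbit_int (0 + h) u - orbit_int 0 u))
      \<longlongrightarrow> W t u - W 0 u) (at_right 0)"
    using assms by (intro tendsto_diff orbit_int_deriv) auto
  then have "((\<lambda>h. (1 / h) *\<^sub>R (orbit_int (t + h) u - orbit_int t u) - (1 / h) *\<^sub>R (orbit_int (0 + h) u - orbit_int 0 u))
      \<longlongrightarrow> W t u - u) (at_right 0)" by simp
  then show ?thesis
  proof (rule Lim_transform_eventually)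
    show "\<forall>\<^sub>F h in at_right 0. (1 / h) *\<^sub>R (orbit_int (t + h) u - orbit_int t u) - (1 / h) *\<^sub>R (orbit_int (0 + h) u - orbit_int 0 u)
        = (1 / h) *\<^sub>R (W h (orbit_int t u) - orbit_int t u)"
      using eventually_at_right_less
    proof (rule eventually_mono)
      fix h :: real assume "0 < h"
      then show "(1 / h) *\<^sub>R (orbit_int (t + h) u - orbit_int t u) - (1 / h) *\<^sub>R (orbit_int (0 + h) u - orbit_int 0 u)
        = (1 / h) *\<^sub>R (W h (orbit_int t u) - orbit_int t u)"
        using assms by (simp add: W_orbit_int orbit_int_shift orbit_int_def[of 0] algebra_simps)
    qed
  qed
qed

lemma orbit_eq_orbit_int:
  assumes "0 \<le> t" "((\<lambda>h. (1 / h) *\<^sub>R (W h x - x)) \<longlongrightarrow> y) (at_right 0)"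
  shows "W t x - x = orbit_int t y"
proof -
  have "((\<lambda>h. orbit_int t ((1 / h) *\<^sub>R (W h x - x))) \<longlongrightarrow> orbit_int t y) (at_right 0)"
    by (intro bounded_linear.tendsto[OF bounded_linear_orbit_int] assms)
  then have "((\<lambda>h. (1 / h) *\<^sub>R (W h (orbit_int t x) - orbit_int t x)) \<longlongrightarrow> orbit_int t y) (at_right 0)"
  proof (rule Lim_transform_eventually)
    show "\<forall>\<^sub>F h in at_right 0. orbit_int t ((1 / h) *\<^sub>R (W h x - x)) = (1 / h) *\<^sub>R (W h (orbit_int t x) - orbit_int t x)"
      using eventually_at_right_less
      by (rule eventually_mono) (simp add: assms(1) W_orbit_int linear_scale linear_diff orbit_int_linear)
  qed
  then show ?thesis
    using tendsto_unique[OF _ _ orbit_int_generator[OF assms(1)]] by (metis trivial_limit_at_right_real)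
qed

end

lemma substochastic_semigroup_bounded:
  fixes V :: "real \<Rightarrow> 'a::abstract_state_space \<Rightarrow> 'a"
  assumes "substochastic_semigroup V"
  obtains M where "bounded_C0_semigroup V M"
proof -
  obtain M where M: "0 < M" "\<And>u::'a.
    \<exists>v w. 0 \<le> v \<and> 0 \<le> w \<and> u = v - w \<and> norm v + norm w \<le> M * norm u"
    by (rule bounded_decomposition) blast
  have "norm (V t u) \<le> M * norm u" if "0 \<le> t" for t u
  proof -
    have V: "substochastic (V t)" using assms that by (simp add: substochastic_semigroup_def)
    then have lin: "linear (V t)" by (simp add: substochastic_def bounded_linear.linear)
    obtain v w where vw: "0 \<le> v" "0 \<le> w" "u = v - w" "norm v + norm w \<le> M * norm u"
      using M(2) by blast
    have "norm (V t u) \<le> norm (V t v) + norm (V t w)"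
      using vw(3) norm_triangle_ineq4 by (simp add: linear_diff[OF lin])
    also have "\<dots> \<le> norm v + norm w" using V vw(1,2) by (simp add: substochastic_def add_mono)
    finally show ?thesis using vw(4) by simp
  qed
  then have "bounded_C0_semigroup V M"
    using assms M(1) by (unfold_locales) (auto simp: substochastic_semigroup_def)
  then show ?thesis using that by blast
qed

definition generator_rel :: "(real \<Rightarrow> 'a::real_normed_vector \<Rightarrow> 'a) \<Rightarrow> 'a \<Rightarrow> 'a \<Rightarrow> bool" where
  "generator_rel V x y \<longleftrightarrow> ((\<lambda>t. (1 / t) *\<^sub>R (V t x - x)) \<longlongrightarrow> y) (at_right 0)"

lemma generator_rel_iff:
  "generator_rel V x y \<longleftrightarrow> x \<in> op_dom (generator V) \<and> op_app (generator V) x = y"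
proof -
  have "Lim (at_right 0) (\<lambda>t. (1 / t) *\<^sub>R (V t x - x)) = y" if "generator_rel V x y" for y
    using that unfolding generator_rel_def by (intro tendsto_Lim) auto
  then show ?thesis by (auto simp: generator_def generator_rel_def)
qed

lemma generator_rel_add:
  assumes "C0_semigroup V" "generator_rel V x y" "generator_rel V x' y'"
  shows "generator_rel V (x + x') (y + y')"
  unfolding generator_rel_def
proof (rule Lim_transform_eventually)
  show "((\<lambda>t. (1 / t) *\<^sub>R (V t x - x) + (1 / t) *\<^sub>R (V t x' - x')) \<longlongrightarrow> y + y') (at_right 0)"
    using assms(2,3) unfolding generator_rel_def by (rule tendsto_add)
  show "\<forall>\<^sub>F t in at_right 0. (1 / t) *\<^sub>R (V t x - x) + (1 / t) *\<^sub>R (V t x' - x')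
      = (1 / t) *\<^sub>R (V t (x + x') - (x + x'))"
    using eventually_at_right_less
  proof (rule eventually_mono)
    fix t :: real assume "0 < t"
    then have "linear (V t)" using assms(1) by (simp add: C0_semigroup_def bounded_linear.linear)
    then show "(1 / t) *\<^sub>R (V t x - x) + (1 / t) *\<^sub>R (V t x' - x')
      = (1 / t) *\<^sub>R (V t (x + x') - (x + x'))"
      by (simp add: linear_add algebra_simps)
  qed
qed

lemma generator_rel_scaleR:
  assumes "C0_semigroup V" "generator_rel V x y"
  shows "generator_rel V (c *\<^sub>R x) (c *\<^sub>R y)"
  unfolding generator_rel_def
proof (rule Lim_transform_eventually)
  show "((\<lambda>t. c *\<^sub>R ((1 / t) *\<^sub>R (V t x - x))) \<longlongrightarrow> c *\<^sub>R y) (at_right 0)"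
    using assms(2) unfolding generator_rel_def by (intro tendsto_intros)
  show "\<forall>\<^sub>F t in at_right 0. c *\<^sub>R ((1 / t) *\<^sub>R (V t x - x)) = (1 / t) *\<^sub>R (V t (c *\<^sub>R x) - c *\<^sub>R x)"
    using eventually_at_right_less
  proof (rule eventually_mono)
    fix t :: real assume "0 < t"
    then have "linear (V t)" using assms(1) by (simp add: C0_semigroup_def bounded_linear.linear)
    then show "c *\<^sub>R ((1 / t) *\<^sub>R (V t x - x)) = (1 / t) *\<^sub>R (V t (c *\<^sub>R x) - c *\<^sub>R x)"
      by (simp add: linear_scale algebra_simps)
  qed
qed

lemma exp_quotient: "((\<lambda>t::real. (1 / t) * (exp (a * t) - 1)) \<longlongrightarrow> a) (at_right 0)"
proof -
  have "((\<lambda>t. exp (a * t)) has_real_derivative a) (at 0)"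
    by (auto intro!: derivative_eq_intros)
  then have "((\<lambda>t. (1 / t) * (exp (a * t) - 1)) \<longlongrightarrow> a) (at 0)"
    by (simp add: has_field_derivative_iff)
  then show ?thesis by (rule filterlim_mono) (auto intro: at_le)
qed

lemma generator_rel_rescale:
  assumes "generator_rel V x y"
  shows "generator_rel (\<lambda>t u. exp (a * t) *\<^sub>R V t u) x (y + a *\<^sub>R x)"
  unfolding generator_rel_def
proof (rule Lim_transform_eventually)
  have "((\<lambda>t::real. exp (a * t)) \<longlongrightarrow> exp (a * 0)) (at_right 0)"
    by (intro tendsto_intros)
  then have "((\<lambda>t. exp (a * t) *\<^sub>R ((1 / t) *\<^sub>R (V t x - x)) + ((1 / t) * (exp (a * t) - 1)) *\<^sub>R x)
      \<longlongrightarrow> exp (a * 0) *\<^sub>R y + a *\<^sub>R x) (at_right 0)"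
    using assms exp_quotient[of a] unfolding generator_rel_def
    by (intro tendsto_add tendsto_scaleR tendsto_const)
  then show "((\<lambda>t. exp (a * t) *\<^sub>R ((1 / t) *\<^sub>R (V t x - x)) + ((1 / t) * (exp (a * t) - 1)) *\<^sub>R x)
      \<longlongrightarrow> y + a *\<^sub>R x) (at_right 0)" by simp
  show "\<forall>\<^sub>F t in at_right 0. exp (a * t) *\<^sub>R ((1 / t) *\<^sub>R (V t x - x)) + ((1 / t) * (exp (a * t) - 1)) *\<^sub>R x
      = (1 / t) *\<^sub>R (exp (a * t) *\<^sub>R V t x - x)"
    by (auto simp: algebra_simps diff_divide_distrib intro!: always_eventually)
qed

lemma C0_semigroup_rescale:
  assumes "C0_semigroup V"
  shows "C0_semigroup (\<lambda>t u. exp (a * t) *\<^sub>R V t u)"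
  unfolding C0_semigroup_def
proof (intro conjI allI impI)
  fix t :: real assume "0 \<le> t"
  then show "bounded_linear (\<lambda>u. exp (a * t) *\<^sub>R V t u)"
    using assms by (intro bounded_linear_const_scaleR) (simp add: C0_semigroup_def)
next
  show "(\<lambda>u. exp (a * 0) *\<^sub>R V 0 u) = id" using assms by (auto simp: C0_semigroup_def)
next
  fix s t :: real assume st: "0 \<le> s" "0 \<le> t"
  then have "linear (V s)" using assms by (simp add: C0_semigroup_def bounded_linear.linear)
  then show "(\<lambda>u. exp (a * (s + t)) *\<^sub>R V (s + t) u)
      = (\<lambda>u. exp (a * s) *\<^sub>R V s u) \<circ> (\<lambda>u. exp (a * t) *\<^sub>R V t u)"
    using assms st by (auto simp: C0_semigroup_def linear_scale exp_add distrib_left)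
next
  fix u
  have "((\<lambda>t. V t u) \<longlongrightarrow> u) (at_right 0)" using assms by (simp add: C0_semigroup_def)
  then have "((\<lambda>t. exp (a * t) *\<^sub>R V t u) \<longlongrightarrow> exp (a * 0) *\<^sub>R u) (at_right 0)"
    by (intro tendsto_intros)
  then show "((\<lambda>t. exp (a * t) *\<^sub>R V t u) \<longlongrightarrow> u) (at_right 0)" by simp
qed

lemma neumann_series:
  fixes T :: "'a::banach \<Rightarrow> 'a"
  assumes "bounded_linear T" "\<And>u. norm (T u) \<le> norm u / 2"
  shows "(\<lambda>n. (T ^^ n) u) sums (\<Sum>n. (T ^^ n) u)"
    and "(\<Sum>n. (T ^^ n) u) - T (\<Sum>n. (T ^^ n) u) = u"
proof -
  have "norm ((T ^^ n) u) \<le> (1 / 2) ^ n * norm u" for n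
  proof (induction n)
    case (Suc n)
    then show ?case using assms(2)[of "(T ^^ n) u"] by simp
  qed simp
  moreover have "summable (\<lambda>n. (1 / 2::real) ^ n * norm u)"
    by (intro summable_mult2 summable_geometric) auto
  ultimately have "summable (\<lambda>n. (T ^^ n) u)" by (blast intro: summable_comparison_test'[where N = 0])
  then show s: "(\<lambda>n. (T ^^ n) u) sums (\<Sum>n. (T ^^ n) u)" by (rule summable_sums)
  have "(\<lambda>n. (T ^^ Suc n) u) sums T (\<Sum>n. (T ^^ n) u)"
    using bounded_linear.sums[OF assms(1) s] by simp
  moreover have "(\<lambda>n. (T ^^ Suc n) u) sums ((\<Sum>n. (T ^^ n) u) - u)"
    using s by (subst sums_Suc_iff) simp
  ultimately show "(\<Sum>n. (T ^^ n) u) - T (\<Sum>n. (T ^^ n) u) = u"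
    using sums_unique2 by fastforce
qed

text \<open>
  With \<open>W t = exp (- \<mu> t) V t\<close> and \<open>t\<close> so large that \<open>W t\<close> has norm at most \<open>1/2\<close>, the solution of
  \<open>\<mu> x - G x = u\<close> is the integral over \<open>[0,t]\<close> of the \<open>W\<close>-orbit of \<open>(1 - W t)\<inverse> u\<close>. This avoids
  the Laplace transform and the closedness of the generator.
\<close>

lemma substochastic_semigroup_resolvent:
  fixes V :: "real \<Rightarrow> 'a::abstract_state_space \<Rightarrow> 'a"
  assumes V: "substochastic_semigroup V" and \<mu>: "0 < \<mu>"
  shows "\<exists>x. generator_rel V x (\<mu> *\<^sub>R x - u) \<and> (0 \<le> u \<longrightarrow> 0 \<le> x)" (is ?ex)
    and "generator_rel V x (\<mu> *\<^sub>R x) \<Longrightarrow> x = 0"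
proof -
  obtain M where "bounded_C0_semigroup V M" using substochastic_semigroup_bounded[OF V] .
  then interpret V: bounded_C0_semigroup V M .
  define W where "W t u = exp (- \<mu> * t) *\<^sub>R V t u" for t u
  have W_eq: "W = (\<lambda>t u. exp (- \<mu> * t) *\<^sub>R V t u)" by (simp add: W_def fun_eq_iff)
  have Wb: "norm (W t u) \<le> exp (- \<mu> * t) * M * norm u" if "0 \<le> t" for t u
    using V.bound[OF that, of u] by (simp add: W_def)
  interpret W: bounded_C0_semigroup W M
  proof
    show "C0_semigroup W" unfolding W_eq by (rule C0_semigroup_rescale[OF V.C0])
    show "norm (W t u) \<le> M * norm u" if "0 \<le> t" for t u
    proof -
      have "exp (- \<mu> * t) * (M * norm u) \<le> 1 * (M * norm u)"
        using \<mu> that V.M_pos by (intro mult_right_mono) auto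
      then show ?thesis using Wb[OF that, of u] by simp
    qed
  qed (rule V.M_pos)
  have relW: "generator_rel W x (y - \<mu> *\<^sub>R x)" if "generator_rel V x y" for x y
    using generator_rel_rescale[OF that, of "- \<mu>"] by (simp add: W_eq)
  have relV: "generator_rel V x (y + \<mu> *\<^sub>R x)" if "generator_rel W x y" for x y
    using generator_rel_rescale[OF that, of \<mu>] by (simp add: W_def exp_minus)
  obtain t where t: "0 \<le> t" "\<And>u. norm (W t u) \<le> norm u / 2"
  proof
    define t where "t = \<bar>ln (2 * M)\<bar> / \<mu>"
    show "0 \<le> t" using \<mu> by (simp add: t_def)
    have "exp (- \<mu> * t) \<le> exp (- ln (2 * M))" using \<mu> by (simp add: t_def)
    also have "\<dots> = 1 / (2 * M)" using V.M_pos by (subst exp_minus) (simp add: inverse_eq_divide)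
    finally have "exp (- \<mu> * t) * M \<le> 1 / (2 * M) * M"
      using V.M_pos by (intro mult_right_mono) auto
    also have "\<dots> = 1 / 2" using V.M_pos by simp
    finally have e: "exp (- \<mu> * t) * M \<le> 1 / 2" .
    show "norm (W t u) \<le> norm u / 2" for u
      using order_trans[OF Wb[OF \<open>0 \<le> t\<close>] mult_right_mono[OF e norm_ge_zero]] by simp
  qed
  define u' where "u' = (\<Sum>n. (W t ^^ n) u)"
  note neu = neumann_series[OF W.bounded_linear_W[OF t(1)] t(2), of u, folded u'_def]
  have "generator_rel W (W.orbit_int t u') (- u)"
    using W.orbit_int_generator[OF t(1), of u'] neu(2) unfolding generator_rel_def by (metis minus_diff_eq)
  then have "generator_rel V (W.orbit_int t u') (\<mu> *\<^sub>R W.orbit_int t u' - u)" using relV by fastforce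
  moreover have "0 \<le> W.orbit_int t u'" if "0 \<le> u"
  proof -
    have Wpos: "0 \<le> W s v" if "0 \<le> s" "0 \<le> v" for s v
      using V that unfolding W_def substochastic_semigroup_def substochastic_def positive_op_def
      by (auto intro!: scaleR_nonneg_nonneg)
    have "0 \<le> (W t ^^ n) u" for n
      by (induction n) (use that Wpos t(1) in auto)
    then have "0 \<le> u'" by (rule cone_sums[OF neu(1)])
    then show ?thesis unfolding W.orbit_int_def using Wpos
      by (intro integral_cone W.integrable_orbit) auto
  qed
  ultimately show ?ex by blast
  show "x = 0" if "generator_rel V x (\<mu> *\<^sub>R x)"
  proof -
    have "generator_rel W x 0" using relW[OF that] by simp
    then have "W t x - x = W.orbit_int t 0"
      unfolding generator_rel_def by (rule W.orbit_eq_orbit_int[OF t(1)])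
    then have "W t x = x" using linear_0[OF W.orbit_int_linear[OF t(1)]] by simp
    then show ?thesis using t(2)[of x] by simp
  qed
qed

locale substochastic_generator =
  fixes T :: "'a::abstract_state_space unbounded_op"
  assumes lin: "linear_op T"
    and gen: "generates_substochastic T"
begin

lemma dom_add: "x \<in> op_dom T \<Longrightarrow> y \<in> op_dom T \<Longrightarrow> x + y \<in> op_dom T"
  and dom_diff: "x \<in> op_dom T \<Longrightarrow> y \<in> op_dom T \<Longrightarrow> x - y \<in> op_dom T"
  and dom_scaleR: "x \<in> op_dom T \<Longrightarrow> c *\<^sub>R x \<in> op_dom T"
  and dom_0: "0 \<in> op_dom T"
  using lin by (auto simp: linear_op_def subspace_add subspace_diff subspace_scale subspace_0)

lemma app_add: "x \<in> op_dom T \<Longrightarrow> y \<in> op_dom T \<Longrightarrow> op_app T (x + y) = op_app T x + op_app T y"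
  and app_scaleR: "x \<in> op_dom T \<Longrightarrow> op_app T (c *\<^sub>R x) = c *\<^sub>R op_app T x"
  using lin by (auto simp: linear_op_def)

lemma app_diff:
  assumes "x \<in> op_dom T" "y \<in> op_dom T"
  shows "op_app T (x - y) = op_app T x - op_app T y"
  using app_add[OF dom_diff[OF assms] assms(2)] by (simp add: algebra_simps)

lemma semigroup:
  obtains S where "substochastic_semigroup S"
    "\<And>x y. generator_rel S x y \<longleftrightarrow> x \<in> op_dom T \<and> op_app T x = y"
proof -
  obtain S where S: "substochastic_semigroup S" "generates T S"
    using gen by (auto simp: generates_substochastic_def)
  then show ?thesis
    by (intro that[of S]) (auto simp: generator_rel_iff generates_def op_equal_def)
qed

context
  fixes \<mu> :: real
  assumes \<mu>: "0 < \<mu>"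
begin

lemma bij: "bij_betw (\<lambda>x. \<mu> *\<^sub>R x - op_app T x) (op_dom T) UNIV"
proof -
  obtain S where S: "substochastic_semigroup S"
    "\<And>x y. generator_rel S x y \<longleftrightarrow> x \<in> op_dom T \<and> op_app T x = y" by (rule semigroup) blast
  show ?thesis
  proof (rule bij_betw_imageI)
    show "inj_on (\<lambda>x. \<mu> *\<^sub>R x - op_app T x) (op_dom T)"
    proof (rule inj_onI)
      fix x y assume xy: "x \<in> op_dom T" "y \<in> op_dom T"
        "\<mu> *\<^sub>R x - op_app T x = \<mu> *\<^sub>R y - op_app T y"
      then have "op_app T (x - y) = \<mu> *\<^sub>R (x - y)" by (simp add: app_diff algebra_simps)
      then have "generator_rel S (x - y) (\<mu> *\<^sub>R (x - y))" using xy S(2) dom_diff by simp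
      then show "x = y" using substochastic_semigroup_resolvent(2)[OF S(1) \<mu>] by fastforce
    qed
    show "(\<lambda>x. \<mu> *\<^sub>R x - op_app T x) ` op_dom T = UNIV"
    proof (intro set_eqI iffI UNIV_I)
      fix u
      obtain x where "generator_rel S x (\<mu> *\<^sub>R x - u)"
        using substochastic_semigroup_resolvent(1)[OF S(1) \<mu>] by blast
      then show "u \<in> (\<lambda>x. \<mu> *\<^sub>R x - op_app T x) ` op_dom T"
        using S(2) by (intro image_eqI[of _ _ x]) auto
    qed
  qed
qed

lemma resolvent_dom: "resolvent \<mu> T u \<in> op_dom T"
  unfolding resolvent_def using bij inv_into_into[of u "\<lambda>x. \<mu> *\<^sub>R x - op_app T x" "op_dom T"]
  by (auto simp: bij_betw_def)

lemma resolvent_right: "\<mu> *\<^sub>R resolvent \<mu> T u - op_app T (resolvent \<mu> T u) = u"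
  unfolding resolvent_def using bij f_inv_into_f[of u "\<lambda>x. \<mu> *\<^sub>R x - op_app T x" "op_dom T"]
  by (auto simp: bij_betw_def)

lemma resolvent_left: "x \<in> op_dom T \<Longrightarrow> resolvent \<mu> T (\<mu> *\<^sub>R x - op_app T x) = x"
  unfolding resolvent_def using bij inv_into_f_f[of "\<lambda>x. \<mu> *\<^sub>R x - op_app T x" "op_dom T" x]
  by (auto simp: bij_betw_def)

lemma app_resolvent: "op_app T (resolvent \<mu> T u) = \<mu> *\<^sub>R resolvent \<mu> T u - u"
  using resolvent_right[of u] by (simp add: algebra_simps)

lemma resolvent_linear: "linear (resolvent \<mu> T)"
proof (rule linearI)
  fix u v c
  show "resolvent \<mu> T (u + v) = resolvent \<mu> T u + resolvent \<mu> T v"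
    using resolvent_left[OF dom_add[OF resolvent_dom[of u] resolvent_dom[of v]]]
    by (simp add: app_add resolvent_dom app_resolvent scaleR_right_distrib add.commute)
  show "resolvent \<mu> T (c *\<^sub>R u) = c *\<^sub>R resolvent \<mu> T u"
    using resolvent_left[OF dom_scaleR[OF resolvent_dom[of u], of c]]
    by (simp add: app_scaleR resolvent_dom app_resolvent scaleR_right_diff_distrib mult.commute)
qed

lemma resolvent_nonneg:
  assumes "0 \<le> u"
  shows "0 \<le> resolvent \<mu> T u"
proof -
  obtain S where S: "substochastic_semigroup S"
    "\<And>x y. generator_rel S x y \<longleftrightarrow> x \<in> op_dom T \<and> op_app T x = y" by (rule semigroup) blast
  obtain x where x: "generator_rel S x (\<mu> *\<^sub>R x - u)" "0 \<le> x"
    using substochastic_semigroup_resolvent(1)[OF S(1) \<mu>] assms by blast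
  then have "x \<in> op_dom T" "\<mu> *\<^sub>R x - op_app T x = u" using S(2) by auto
  then show ?thesis using resolvent_left[of x] x(2) by simp
qed

lemma resolvent_mono: "u \<le> v \<Longrightarrow> resolvent \<mu> T u \<le> resolvent \<mu> T v"
  using resolvent_nonneg[of "v - u"] by (simp add: linear_diff[OF resolvent_linear])

end

end

lemma substochastic_generator_generator:
  assumes "substochastic_semigroup V"
  shows "substochastic_generator (generator V)"
proof
  have C0: "C0_semigroup V" using assms by (simp add: substochastic_semigroup_def)
  note rel = generator_rel_iff[of V]
  show "generates_substochastic (generator V)"
    using assms C0 by (auto simp: generates_substochastic_def generates_def op_equal_def)
  show "linear_op (generator V)"
    unfolding linear_op_def
  proof (intro conjI ballI allI subspaceI)
    have "generator_rel V 0 0" using C0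
      by (auto simp: generator_rel_def C0_semigroup_def bounded_linear.linear linear_0
          intro!: tendsto_eventually eventually_mono[OF eventually_at_right_less])
    then show "0 \<in> op_dom (generator V)" using rel by blast
  qed (use generator_rel_add[OF C0] generator_rel_scaleR[OF C0] rel in blast)+
qed

subsection \<open>The Kato series\<close>

locale kato_pair =
  fixes A B :: "'a::abstract_state_space unbounded_op"
  assumes kato: "kato_conditions A B"
begin

sublocale A: substochastic_generator A
  using kato by unfold_locales (auto simp: kato_conditions_def)

lemma B_add: "x \<in> op_dom A \<Longrightarrow> y \<in> op_dom A \<Longrightarrow> op_app B (x + y) = op_app B x + op_app B y"
  and B_scaleR: "x \<in> op_dom A \<Longrightarrow> op_app B (c *\<^sub>R x) = c *\<^sub>R op_app B x"
  and B_nonneg: "x \<in> op_dom A \<Longrightarrow> 0 \<le> x \<Longrightarrow> 0 \<le> op_app B x"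
  using kato by (auto simp: kato_conditions_def linear_op_def subset_iff)

lemma B_diff:
  assumes "x \<in> op_dom A" "y \<in> op_dom A"
  shows "op_app B (x - y) = op_app B x - op_app B y"
  using B_add[OF A.dom_diff[OF assms] assms(2)] by (simp add: algebra_simps)

lemma B_mono: "x \<in> op_dom A \<Longrightarrow> y \<in> op_dom A \<Longrightarrow> x \<le> y \<Longrightarrow> op_app B x \<le> op_app B y"
  using B_nonneg[of "y - x"] by (simp add: A.dom_diff B_diff)

lemma a_nonneg: "x \<in> op_dom A \<Longrightarrow> 0 \<le> x \<Longrightarrow> 0 \<le> a_fun A B x"
  using kato by (auto simp: kato_conditions_def a_fun_def op_plus_def)

lemma a_add: "x \<in> op_dom A \<Longrightarrow> y \<in> op_dom A \<Longrightarrow> a_fun A B (x + y) = a_fun A B x + a_fun A B y"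
  by (simp add: a_fun_def A.app_add B_add blinfun.add_right)

lemma a_diff: "x \<in> op_dom A \<Longrightarrow> y \<in> op_dom A \<Longrightarrow> a_fun A B (x - y) = a_fun A B x - a_fun A B y"
  by (simp add: a_fun_def A.app_diff B_diff blinfun.add_right blinfun.diff_right)

lemma a_scaleR: "x \<in> op_dom A \<Longrightarrow> a_fun A B (c *\<^sub>R x) = c * a_fun A B x"
  by (simp add: a_fun_def A.app_scaleR B_scaleR blinfun.add_right blinfun.scaleR_right algebra_simps)

lemma a_mono: "x \<in> op_dom A \<Longrightarrow> y \<in> op_dom A \<Longrightarrow> x \<le> y \<Longrightarrow> a_fun A B x \<le> a_fun A B y"
  using a_nonneg[of "y - x"] by (simp add: A.dom_diff a_diff)

definition BR :: "real \<Rightarrow> 'a \<Rightarrow> 'a" where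
  "BR \<mu> u = op_app B (resolvent \<mu> A u)"

definition kato_sum :: "real \<Rightarrow> nat \<Rightarrow> 'a \<Rightarrow> 'a" where
  "kato_sum \<mu> n u = (\<Sum>k<n. kato_term A B \<mu> k u)"

lemma kato_term_eq: "kato_term A B \<mu> k u = resolvent \<mu> A ((BR \<mu> ^^ k) u)"
  by (simp add: kato_term_def BR_def[abs_def])

context
  fixes \<mu> :: real
  assumes \<mu>: "0 < \<mu>"
begin

lemma BR_linear: "linear (BR \<mu>)"
  by (rule linearI) (simp_all add: BR_def linear_add linear_scale A.resolvent_linear A.resolvent_dom
      B_add B_scaleR \<mu>)

lemma BR_nonneg: "0 \<le> u \<Longrightarrow> 0 \<le> BR \<mu> u"
  by (simp add: BR_def B_nonneg A.resolvent_dom A.resolvent_nonneg \<mu>)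

lemma a_resolvent:
  "a_fun A B (resolvent \<mu> A u)
    = blinfun_apply Psi u - \<mu> * blinfun_apply Psi (resolvent \<mu> A u) - blinfun_apply Psi (BR \<mu> u)"
  by (simp add: a_fun_def A.app_resolvent \<mu> BR_def blinfun.add_right blinfun.diff_right
      blinfun.scaleR_right)

lemma norm_BR_resolvent:
  assumes "0 \<le> u"
  shows "norm (BR \<mu> u) + \<mu> * norm (resolvent \<mu> A u) \<le> norm u"
  using a_nonneg[OF A.resolvent_dom[OF \<mu>] A.resolvent_nonneg[OF \<mu> assms]] assms
  by (simp add: a_resolvent Psi_cone BR_nonneg A.resolvent_nonneg \<mu>)

lemma norm_BR: "0 \<le> u \<Longrightarrow> norm (BR \<mu> u) \<le> norm u"
  using norm_BR_resolvent[of u] \<mu> by (smt (verit) mult_nonneg_nonneg norm_ge_zero)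

lemma bounded_linear_BR: "bounded_linear (BR \<mu>)"
  by (rule bounded_linear_of_cone[where c = 1]) (simp_all add: BR_linear norm_BR)

lemma BR_power_linear: "linear (BR \<mu> ^^ n)"
  by (induction n) (simp_all only: funpow.simps linear_id linear_compose BR_linear)

lemma BR_power_nonneg: "0 \<le> u \<Longrightarrow> 0 \<le> (BR \<mu> ^^ n) u"
  by (induction n) (auto simp: BR_nonneg)

lemma norm_BR_power: "0 \<le> u \<Longrightarrow> norm ((BR \<mu> ^^ n) u) \<le> norm u"
  by (induction n) (auto intro: order_trans norm_BR BR_power_nonneg)

lemma kato_term_dom: "kato_term A B \<mu> k u \<in> op_dom A"
  by (simp add: kato_term_eq A.resolvent_dom \<mu>)

lemma kato_term_nonneg: "0 \<le> u \<Longrightarrow> 0 \<le> kato_term A B \<mu> k u"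
  by (simp add: kato_term_eq A.resolvent_nonneg BR_power_nonneg \<mu>)

lemma kato_term_linear: "linear (kato_term A B \<mu> k)"
  using linear_compose[OF BR_power_linear A.resolvent_linear[OF \<mu>]]
  by (simp add: kato_term_eq[abs_def] o_def)

lemma kato_sum_Suc: "kato_sum \<mu> (Suc n) u = kato_sum \<mu> n u + kato_term A B \<mu> n u"
  by (simp add: kato_sum_def)

lemma kato_sum_0 [simp]: "kato_sum \<mu> 0 u = 0"
  by (simp add: kato_sum_def)

lemma kato_sum_dom: "kato_sum \<mu> n u \<in> op_dom A"
  by (induction n) (auto simp: kato_sum_Suc A.dom_0 A.dom_add kato_term_dom)

lemma kato_sum_nonneg: "0 \<le> u \<Longrightarrow> 0 \<le> kato_sum \<mu> n u"
  by (simp add: kato_sum_def sum_nonneg kato_term_nonneg)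

lemma kato_sum_linear: "linear (kato_sum \<mu> n)"
  unfolding kato_sum_def[abs_def] by (intro linear_compose_sum ballI kato_term_linear)

lemma kato_sum_mono: "0 \<le> u \<Longrightarrow> m \<le> n \<Longrightarrow> kato_sum \<mu> m u \<le> kato_sum \<mu> n u"
  unfolding kato_sum_def by (intro sum_mono2) (auto simp: kato_term_nonneg)

lemma kato_sum_Suc_resolvent:
  "kato_sum \<mu> (Suc n) u = resolvent \<mu> A (u + op_app B (kato_sum \<mu> n u))"
proof (induction n)
  case 0
  have "op_app B (0 :: 'a) = 0" using B_scaleR[OF A.dom_0, of 0] by simp
  then show ?case by (simp add: kato_sum_Suc kato_term_eq)
next
  case (Suc n)
  have "kato_sum \<mu> (Suc (Suc n)) u
      = resolvent \<mu> A (u + op_app B (kato_sum \<mu> n u)) + resolvent \<mu> A (BR \<mu> ((BR \<mu> ^^ n) u))"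
    unfolding kato_sum_Suc[of "Suc n"] Suc by (simp add: kato_term_eq)
  also have "\<dots> = resolvent \<mu> A (u + (op_app B (kato_sum \<mu> n u) + op_app B (kato_term A B \<mu> n u)))"
    by (simp add: linear_add[OF A.resolvent_linear[OF \<mu>]] BR_def kato_term_eq add.assoc)
  finally show ?case by (simp add: kato_sum_Suc B_add kato_sum_dom kato_term_dom)
qed

lemma shifted_kato_sum:
  "\<nu> *\<^sub>R kato_sum \<mu> (Suc n) u - op_app A (kato_sum \<mu> (Suc n) u)
    = u + (\<nu> - \<mu>) *\<^sub>R kato_sum \<mu> (Suc n) u + op_app B (kato_sum \<mu> n u)"
  unfolding kato_sum_Suc_resolvent by (simp add: A.app_resolvent \<mu> algebra_simps)

lemma a_kato_sum_sum: "a_fun A B (kato_sum \<mu> n u) = (\<Sum>k<n. a_fun A B (kato_term A B \<mu> k u))"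
proof (induction n)
  case 0
  show ?case using a_scaleR[OF A.dom_0, of 0] by simp
qed (simp add: kato_sum_Suc a_add kato_sum_dom kato_term_dom)

lemma a_kato_sum:
  "a_fun A B (kato_sum \<mu> n u) = blinfun_apply Psi u - \<mu> * blinfun_apply Psi (kato_sum \<mu> n u)
    - blinfun_apply Psi ((BR \<mu> ^^ n) u)"
  unfolding a_kato_sum_sum
  by (induction n) (simp_all add: kato_sum_Suc kato_term_eq a_resolvent blinfun.add_right distrib_left)

lemma a_kato_term_nonneg: "0 \<le> u \<Longrightarrow> 0 \<le> a_fun A B (kato_term A B \<mu> k u)"
  by (simp add: a_nonneg kato_term_dom kato_term_nonneg)

lemma a_kato_sum_le_norm:
  assumes "0 \<le> u"
  shows "a_fun A B (kato_sum \<mu> n u) \<le> norm u"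
proof -
  have "0 \<le> \<mu> * norm (kato_sum \<mu> n u)" using \<mu> by simp
  then show ?thesis
    using assms norm_ge_zero[of "(BR \<mu> ^^ n) u"]
    by (simp add: a_kato_sum Psi_cone kato_sum_nonneg BR_power_nonneg del: norm_ge_zero)
qed

lemma a_kato_summable: "summable (\<lambda>k. a_fun A B (kato_term A B \<mu> k u))"
proof -
  have pos: "summable (\<lambda>k. a_fun A B (kato_term A B \<mu> k u))" if "0 \<le> u" for u
  proof (rule summableI_nonneg_bounded)
    show "(\<Sum>k<n. a_fun A B (kato_term A B \<mu> k u)) \<le> norm u" for n
      using a_kato_sum_le_norm[OF that] by (simp add: a_kato_sum_sum)
  qed (simp add: a_kato_term_nonneg that)
  obtain v w where vw: "0 \<le> v" "0 \<le> w" "u = v - w" using generating_cone by blast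
  show ?thesis
    using summable_diff[OF pos[OF vw(1)] pos[OF vw(2)]]
    by (simp add: vw(3) linear_diff[OF kato_term_linear] a_diff kato_term_dom)
qed

end

definition a_series :: "real \<Rightarrow> 'a \<Rightarrow> real" where
  "a_series \<mu> u = (\<Sum>k. a_fun A B (kato_term A B \<mu> k u))"

lemma a_series_sums: "0 < \<mu> \<Longrightarrow> (\<lambda>k. a_fun A B (kato_term A B \<mu> k u)) sums a_series \<mu> u"
  unfolding a_series_def using a_kato_summable by (rule summable_sums)

lemma a_kato_sum_tendsto: "0 < \<mu> \<Longrightarrow> (\<lambda>n. a_fun A B (kato_sum \<mu> n u)) \<longlonglongrightarrow> a_series \<mu> u"
  using a_series_sums[of \<mu> u] by (simp add: a_kato_sum_sum sums_def)

lemma a_kato_sum_le_series: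
  assumes "0 < \<mu>" "0 \<le> u"
  shows "a_fun A B (kato_sum \<mu> n u) \<le> a_series \<mu> u"
  unfolding a_series_def a_kato_sum_sum[OF assms(1)]
  using assms by (intro sum_le_suminf a_kato_summable) (auto simp: a_kato_term_nonneg)

lemma a_series_linear:
  assumes "0 < \<mu>"
  shows "linear (a_series \<mu>)"
proof (rule linearI)
  fix u v c
  show "a_series \<mu> (u + v) = a_series \<mu> u + a_series \<mu> v"
    unfolding a_series_def using assms
    by (simp add: linear_add[OF kato_term_linear] a_add kato_term_dom suminf_add a_kato_summable)
  show "a_series \<mu> (c *\<^sub>R u) = c *\<^sub>R a_series \<mu> u"
    unfolding a_series_def using assms
    by (simp add: linear_scale[OF kato_term_linear] a_scaleR kato_term_dom suminf_mult a_kato_summable)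
qed

end

subsection \<open>The extended functional and honesty\<close>

locale kato_perturbation = kato_pair A B
  for A B :: "'a::abstract_state_space unbounded_op" +
  fixes V :: "real \<Rightarrow> 'a \<Rightarrow> 'a"
  assumes kato_semigroup: "kato_semigroup A B V"
begin

lemma V: "substochastic_semigroup V"
  using kato_semigroup by (simp add: kato_semigroup_def)

abbreviation G where "G \<equiv> generator V"

sublocale G: substochastic_generator "generator V"
  by (rule substochastic_generator_generator[OF V])

lemma kato_sum_tendsto: "0 < \<mu> \<Longrightarrow> (\<lambda>n. kato_sum \<mu> n u) \<longlonglongrightarrow> resolvent \<mu> G u"
  using kato_semigroup by (simp add: kato_semigroup_def kato_sum_def sums_def)

lemma kato_sum_le:
  assumes "0 < \<mu>" "0 \<le> u"
  shows "kato_sum \<mu> n u \<le> resolvent \<mu> G u"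
  by (rule cone_limit_le[OF tendsto_const LIMSEQ_ignore_initial_segment[OF kato_sum_tendsto, of _ n]])
    (use assms kato_sum_mono in auto)

text \<open>
  Independence of the parameter: the partial sums for \<open>\<kappa>\<close> at \<open>u\<close> lie below those for \<open>\<mu>\<close> at \<open>w\<close>,
  where \<open>w = u + (\<mu> - \<kappa>) R(\<kappa>,G) u\<close>; the reverse comparison holds once \<open>R(\<kappa>,G) u\<close> in \<open>w\<close>
  is replaced by a partial sum of its series.
\<close>

lemma a_series_shift_nonneg:
  assumes \<kappa>: "0 < \<kappa>" "\<kappa> \<le> \<mu>" and u: "0 \<le> u"
  shows "a_series \<kappa> u = a_series \<mu> (u + (\<mu> - \<kappa>) *\<^sub>R resolvent \<kappa> G u)"
proof (rule antisym)
  define x where "x = resolvent \<kappa> G u"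
  define w where "w = u + (\<mu> - \<kappa>) *\<^sub>R x"
  have \<mu>: "0 < \<mu>" using \<kappa> by simp
  have x: "0 \<le> x" using \<kappa>(1) u by (simp add: x_def G.resolvent_nonneg)
  have w: "0 \<le> w" using \<kappa> u x by (simp add: w_def scaleR_nonneg_nonneg)
  note dom = kato_sum_dom[OF \<kappa>(1)] kato_sum_dom[OF \<mu>]
  have le1: "kato_sum \<kappa> n u \<le> kato_sum \<mu> n w" for n
  proof (induction n)
    case 0
    show ?case by (simp add: kato_sum_0[OF \<kappa>(1)] kato_sum_0[OF \<mu>])
  next
    case (Suc n)
    have "kato_sum \<kappa> (Suc n) u = resolvent \<mu> A
        (u + (\<mu> - \<kappa>) *\<^sub>R kato_sum \<kappa> (Suc n) u + op_app B (kato_sum \<kappa> n u))"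
      unfolding shifted_kato_sum[OF \<kappa>(1), symmetric] using dom(1) \<mu> by (simp add: A.resolvent_left)
    also have "\<dots> \<le> resolvent \<mu> A (w + op_app B (kato_sum \<mu> n w))"
      unfolding w_def using \<kappa> u Suc
      by (intro A.resolvent_mono \<mu> add_mono scaleR_left_mono B_mono dom)
        (auto simp: x_def kato_sum_le w_def)
    also have "\<dots> = kato_sum \<mu> (Suc n) w" by (rule kato_sum_Suc_resolvent[OF \<mu>, symmetric])
    finally show ?case .
  qed
  have "a_fun A B (kato_sum \<kappa> n u) \<le> a_series \<mu> w" for n
    using a_mono[OF dom le1] a_kato_sum_le_series[OF \<mu> w] by (rule order_trans)
  then show "a_series \<kappa> u \<le> a_series \<mu> (u + (\<mu> - \<kappa>) *\<^sub>R resolvent \<kappa> G u)"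
    unfolding w_def x_def by (intro LIMSEQ_le_const2[OF a_kato_sum_tendsto[OF \<kappa>(1)]]) auto
  have le2: "kato_sum \<mu> n (u + (\<mu> - \<kappa>) *\<^sub>R kato_sum \<kappa> m u) \<le> kato_sum \<kappa> (m + n) u" for n m
  proof (induction n)
    case 0
    show ?case using kato_sum_nonneg[OF \<kappa>(1) u] by (simp add: kato_sum_0[OF \<mu>])
  next
    case (Suc n)
    let ?w = "u + (\<mu> - \<kappa>) *\<^sub>R kato_sum \<kappa> m u"
    have "kato_sum \<mu> (Suc n) ?w = resolvent \<mu> A (?w + op_app B (kato_sum \<mu> n ?w))"
      by (rule kato_sum_Suc_resolvent[OF \<mu>])
    also have "\<dots> \<le> resolvent \<mu> A
        (u + (\<mu> - \<kappa>) *\<^sub>R kato_sum \<kappa> (Suc (m + n)) u + op_app B (kato_sum \<kappa> (m + n) u))"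
      using \<kappa> u Suc
      by (intro A.resolvent_mono \<mu> add_mono scaleR_left_mono B_mono dom kato_sum_mono) auto
    also have "\<dots> = kato_sum \<kappa> (Suc (m + n)) u"
      unfolding shifted_kato_sum[OF \<kappa>(1), symmetric] using dom(1) \<mu> by (simp add: A.resolvent_left)
    finally show ?case by simp
  qed
  have "a_fun A B (kato_sum \<mu> n w) \<le> a_series \<kappa> u" for n
  proof -
    have "a_fun A B (kato_sum \<mu> n w) \<le> a_series \<kappa> u + (\<mu> - \<kappa>) * norm (x - kato_sum \<kappa> m u)" for m
    proof -
      let ?w = "u + (\<mu> - \<kappa>) *\<^sub>R kato_sum \<kappa> m u"
      have "0 \<le> x - kato_sum \<kappa> m u" using kato_sum_le[OF \<kappa>(1) u] by (simp add: x_def)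
      then have *: "a_fun A B (kato_sum \<mu> n (x - kato_sum \<kappa> m u)) \<le> norm (x - kato_sum \<kappa> m u)"
        by (rule a_kato_sum_le_norm[OF \<mu>])
      have "w = ?w + (\<mu> - \<kappa>) *\<^sub>R (x - kato_sum \<kappa> m u)" by (simp add: w_def algebra_simps)
      then have "kato_sum \<mu> n w = kato_sum \<mu> n ?w + (\<mu> - \<kappa>) *\<^sub>R kato_sum \<mu> n (x - kato_sum \<kappa> m u)"
        by (simp only: linear_add[OF kato_sum_linear[OF \<mu>]] linear_scale[OF kato_sum_linear[OF \<mu>]])
      then have "a_fun A B (kato_sum \<mu> n w)
          = a_fun A B (kato_sum \<mu> n ?w) + (\<mu> - \<kappa>) * a_fun A B (kato_sum \<mu> n (x - kato_sum \<kappa> m u))"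
        by (simp only: a_add a_scaleR A.dom_scaleR dom)
      moreover have "a_fun A B (kato_sum \<mu> n ?w) \<le> a_series \<kappa> u"
        using a_mono[OF dom(2,1) le2] a_kato_sum_le_series[OF \<kappa>(1) u] by (rule order_trans)
      ultimately show ?thesis using mult_left_mono[OF *, of "\<mu> - \<kappa>"] \<kappa>(2) by simp
    qed
    moreover have "(\<lambda>m. a_series \<kappa> u + (\<mu> - \<kappa>) * norm (x - kato_sum \<kappa> m u))
        \<longlonglongrightarrow> a_series \<kappa> u + (\<mu> - \<kappa>) * norm (x - x)"
      unfolding x_def by (intro tendsto_intros kato_sum_tendsto \<kappa>)
    ultimately show ?thesis
      using LIMSEQ_le_const[of "\<lambda>m. a_series \<kappa> u + (\<mu> - \<kappa>) * norm (x - kato_sum \<kappa> m u)"]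
      by simp
  qed
  then show "a_series \<mu> (u + (\<mu> - \<kappa>) *\<^sub>R resolvent \<kappa> G u) \<le> a_series \<kappa> u"
    unfolding w_def x_def by (intro LIMSEQ_le_const2[OF a_kato_sum_tendsto[OF \<mu>]]) auto
qed

lemma a_series_shift:
  assumes \<kappa>: "0 < \<kappa>" "\<kappa> \<le> \<mu>"
  shows "a_series \<kappa> u = a_series \<mu> (u + (\<mu> - \<kappa>) *\<^sub>R resolvent \<kappa> G u)"
proof -
  have \<mu>: "0 < \<mu>" using \<kappa> by simp
  obtain v w where vw: "0 \<le> v" "0 \<le> w" "u = v - w" using generating_cone by blast
  have eq: "u + (\<mu> - \<kappa>) *\<^sub>R resolvent \<kappa> G u
      = (v + (\<mu> - \<kappa>) *\<^sub>R resolvent \<kappa> G v) - (w + (\<mu> - \<kappa>) *\<^sub>R resolvent \<kappa> G w)"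
    by (simp add: vw(3) linear_diff[OF G.resolvent_linear[OF \<kappa>(1)]] algebra_simps)
  have "a_series \<mu> (u + (\<mu> - \<kappa>) *\<^sub>R resolvent \<kappa> G u) = a_series \<kappa> v - a_series \<kappa> w"
    unfolding eq a_series_shift_nonneg[OF \<kappa> vw(1)] a_series_shift_nonneg[OF \<kappa> vw(2)]
    by (rule linear_diff[OF a_series_linear[OF \<mu>]])
  then show ?thesis by (simp add: vw(3) linear_diff[OF a_series_linear[OF \<kappa>(1)]])
qed

lemma a_series_resolvent_cong:
  assumes "0 < \<kappa>" "0 < \<mu>" "resolvent \<kappa> G u = resolvent \<mu> G w"
  shows "a_series \<kappa> u = a_series \<mu> w"
proof -
  have *: "a_series \<kappa> u = a_series \<mu> w"
    if "0 < \<kappa>" "\<kappa> \<le> \<mu>" "resolvent \<kappa> G u = resolvent \<mu> G w" for \<kappa> \<mu> u w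
  proof -
    have "w = u + (\<mu> - \<kappa>) *\<^sub>R resolvent \<kappa> G u"
      using G.resolvent_right[of \<mu> w] G.resolvent_right[of \<kappa> u] that
      by (simp add: algebra_simps)
    then show ?thesis using a_series_shift that by simp
  qed
  show ?thesis using *[of \<kappa> \<mu> u w] *[of \<mu> \<kappa> w u] assms by (cases "\<kappa> \<le> \<mu>") auto
qed

lemma a_bar_resolvent:
  assumes "0 < \<mu>"
  shows "a_bar A B G (resolvent \<mu> G u) = a_series \<mu> u"
  unfolding a_bar_def
proof (rule the_equality)
  show "\<forall>\<nu>>0. \<forall>w. resolvent \<nu> G w = resolvent \<mu> G u \<longrightarrow>
      (\<lambda>k. a_fun A B (kato_term A B \<nu> k w)) sums a_series \<mu> u"
    using a_series_sums a_series_resolvent_cong assms by metis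
  fix r
  assume "\<forall>\<nu>>0. \<forall>w. resolvent \<nu> G w = resolvent \<mu> G u \<longrightarrow>
      (\<lambda>k. a_fun A B (kato_term A B \<nu> k w)) sums r"
  then have "(\<lambda>k. a_fun A B (kato_term A B \<mu> k u)) sums r" using assms by blast
  then show "r = a_series \<mu> u" using sums_unique2[OF _ a_series_sums[OF assms]] by blast
qed

definition defect :: "real \<Rightarrow> 'a \<Rightarrow> real" where
  "defect \<mu> u = blinfun_apply Psi u - \<mu> * blinfun_apply Psi (resolvent \<mu> G u) - a_series \<mu> u"

context
  fixes \<mu> :: real
  assumes \<mu>: "0 < \<mu>"
begin

lemma defect_tendsto: "(\<lambda>n. blinfun_apply Psi ((BR \<mu> ^^ n) u)) \<longlonglongrightarrow> defect \<mu> u"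
proof -
  have "(\<lambda>n. blinfun_apply Psi u - \<mu> * blinfun_apply Psi (kato_sum \<mu> n u)
      - a_fun A B (kato_sum \<mu> n u)) \<longlonglongrightarrow> defect \<mu> u"
    unfolding defect_def using \<mu>
    by (intro tendsto_intros bounded_linear.tendsto[OF blinfun.bounded_linear_right]
        kato_sum_tendsto a_kato_sum_tendsto)
  then show ?thesis by (simp add: a_kato_sum[OF \<mu>])
qed

lemma defect_linear: "linear (defect \<mu>)"
proof (rule linearI)
  fix u v c
  show "defect \<mu> (u + v) = defect \<mu> u + defect \<mu> v"
    by (simp add: defect_def linear_add[OF G.resolvent_linear[OF \<mu>]]
        linear_add[OF a_series_linear[OF \<mu>]] blinfun.add_right algebra_simps)
  show "defect \<mu> (c *\<^sub>R u) = c *\<^sub>R defect \<mu> u"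
    by (simp add: defect_def linear_scale[OF G.resolvent_linear[OF \<mu>]]
        linear_scale[OF a_series_linear[OF \<mu>]] blinfun.scaleR_right algebra_simps)
qed

lemma norm_BR_power_tendsto:
  assumes "0 \<le> u"
  shows "(\<lambda>n. norm ((BR \<mu> ^^ n) u)) \<longlonglongrightarrow> defect \<mu> u"
  using defect_tendsto[of u] assms by (simp add: Psi_cone BR_power_nonneg \<mu>)

lemma defect_nonneg: "0 \<le> u \<Longrightarrow> 0 \<le> defect \<mu> u"
  by (rule LIMSEQ_le_const[OF norm_BR_power_tendsto]) auto

lemma defect_le_norm: "0 \<le> u \<Longrightarrow> defect \<mu> u \<le> norm u"
  by (rule LIMSEQ_le_const2[OF norm_BR_power_tendsto]) (auto simp: norm_BR_power \<mu>)

lemma bounded_linear_defect: "bounded_linear (defect \<mu>)"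
  by (rule bounded_linear_of_cone[where c = 1])
    (simp_all add: defect_linear defect_nonneg defect_le_norm)

lemma a_bar_defect:
  assumes "x \<in> op_dom G"
  shows "a_bar A B G x = - blinfun_apply Psi (op_app G x) - defect \<mu> (\<mu> *\<^sub>R x - op_app G x)"
  using a_bar_resolvent[OF \<mu>, of "\<mu> *\<^sub>R x - op_app G x"] assms
  by (simp add: defect_def G.resolvent_left \<mu> blinfun.diff_right blinfun.scaleR_right)

lemma honest_iff_defect:
  "honest A B V \<longleftrightarrow> (\<forall>t\<ge>0. \<forall>u\<ge>0.
    defect \<mu> (V t u) - defect \<mu> u = \<mu> * defect \<mu> (integral {0..t} (\<lambda>s. V s u)))"
proof -
  obtain M where "bounded_C0_semigroup V M" using substochastic_semigroup_bounded[OF V] .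
  then interpret V: bounded_C0_semigroup V M .
  have "norm (V t u) - norm u = - a_bar A B G (integral {0..t} (\<lambda>s. V s u)) \<longleftrightarrow>
      defect \<mu> (V t u) - defect \<mu> u = \<mu> * defect \<mu> (integral {0..t} (\<lambda>s. V s u))"
    if t: "0 \<le> t" and u: "0 \<le> u" for t u
  proof -
    define z where "z = integral {0..t} (\<lambda>s. V s u)"
    have "generator_rel V z (V t u - u)"
      using V.orbit_int_generator[OF t] by (simp add: generator_rel_def z_def V.orbit_int_def)
    then have z: "z \<in> op_dom G" "op_app G z = V t u - u" by (auto simp: generator_rel_iff)
    have "0 \<le> V t u"
      using V t u by (simp add: substochastic_semigroup_def substochastic_def positive_op_def)
    then have "norm (V t u) - norm u = - a_bar A B G z \<longleftrightarrow> defect \<mu> (\<mu> *\<^sub>R z - (V t u - u)) = 0"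
      using u by (auto simp: a_bar_defect[OF z(1)] z(2) Psi_cone blinfun.diff_right)
    then show ?thesis
      by (auto simp: linear_diff[OF defect_linear] linear_scale[OF defect_linear] z_def)
  qed
  then show ?thesis by (simp add: honest_def)
qed

lemma honest_iff: "honest A B V \<longleftrightarrow> (\<forall>u\<ge>0. (\<lambda>n. (BR \<mu> ^^ n) u) \<longlonglongrightarrow> 0)"
proof -
  obtain M where "bounded_C0_semigroup V M" using substochastic_semigroup_bounded[OF V] .
  then interpret V: bounded_C0_semigroup V M .
  have Vpos: "0 \<le> V t u" and Vnorm: "norm (V t u) \<le> norm u" if "0 \<le> t" "0 \<le> u" for t u
    using V that by (simp_all add: substochastic_semigroup_def substochastic_def positive_op_def)
  have "honest A B V \<longleftrightarrow> (\<forall>u\<ge>0. defect \<mu> u = 0)"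
  proof
    assume "honest A B V"
    then have h: "defect \<mu> (V t u) - defect \<mu> u = \<mu> * defect \<mu> (integral {0..t} (\<lambda>s. V s u))"
      if "0 \<le> t" "0 \<le> u" for t u
      using that honest_iff_defect by blast
    show "\<forall>u\<ge>0. defect \<mu> u = 0"
    proof (intro allI impI)
      fix u :: 'a assume u: "0 \<le> u"
      have mono: "defect \<mu> u \<le> defect \<mu> (V t u)" if "0 \<le> t" for t
      proof -
        have "0 \<le> integral {0..t} (\<lambda>s. V s u)"
          using Vpos u by (intro integral_cone V.integrable_orbit) auto
        then have "0 \<le> \<mu> * defect \<mu> (integral {0..t} (\<lambda>s. V s u))"
          using \<mu> defect_nonneg by simp
        then show ?thesis using h[OF that u] by simp
      qed
      have grow: "defect \<mu> u * (1 + \<mu> * t) \<le> norm u" if t: "0 \<le> t" for t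
      proof -
        have int: "(\<lambda>s. V s u) integrable_on {0..t}" by (rule V.integrable_orbit) simp
        have "t * defect \<mu> u = integral {0..t} (\<lambda>s. defect \<mu> u)" using t by simp
        also have "\<dots> \<le> integral {0..t} (defect \<mu> \<circ> (\<lambda>s. V s u))"
          using mono integrable_linear[OF int bounded_linear_defect] by (intro integral_le) auto
        also have "\<dots> = defect \<mu> (integral {0..t} (\<lambda>s. V s u))"
          by (rule integral_linear[OF int bounded_linear_defect])
        finally have "\<mu> * (t * defect \<mu> u) \<le> defect \<mu> (V t u) - defect \<mu> u"
          unfolding h[OF t u] using \<mu> by (intro mult_left_mono) auto
        moreover have "defect \<mu> (V t u) \<le> norm u"
          using defect_le_norm[OF Vpos[OF t u]] Vnorm[OF t u] by simp
        ultimately show ?thesis by (simp add: algebra_simps)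
      qed
      show "defect \<mu> u = 0"
      proof (rule ccontr)
        assume "defect \<mu> u \<noteq> 0"
        then have d: "0 < defect \<mu> u" using defect_nonneg[OF u] by simp
        define t where "t = norm u / (\<mu> * defect \<mu> u)"
        have "0 \<le> t" "defect \<mu> u * (\<mu> * t) = norm u" using d \<mu> by (simp_all add: t_def)
        then show False using grow[of t] d by (simp add: distrib_left)
      qed
    qed
  next
    assume d: "\<forall>u\<ge>0. defect \<mu> u = 0"
    have "defect \<mu> u = 0" for u
    proof -
      obtain v w where "0 \<le> v" "0 \<le> w" "u = v - w" using generating_cone by blast
      then show ?thesis using d by (simp add: linear_diff[OF defect_linear])
    qed
    then show "honest A B V" by (simp add: honest_iff_defect)
  qed
  also have "\<dots> \<longleftrightarrow> (\<forall>u\<ge>0. (\<lambda>n. (BR \<mu> ^^ n) u) \<longlonglongrightarrow> 0)"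
    using norm_BR_power_tendsto LIMSEQ_unique by (metis tendsto_norm_zero_iff)
  finally show ?thesis .
qed

end

end

theorem proposition4p1:
  fixes A B K A\<^sub>K :: "'a::abstract_state_space unbounded_op"
    and V V\<^sub>K :: "real \<Rightarrow> 'a \<Rightarrow> 'a"
  assumes "kato_conditions A B"
    and "kato_semigroup A B V"
    and "honest A B V"
    and "linear_op K" and "positive_op K"
    and "op_extends A\<^sub>K (op_minus A K)"
    and "generates_substochastic A\<^sub>K"
    and "kato_conditions A\<^sub>K B"
    and "kato_semigroup A\<^sub>K B V\<^sub>K"
    and dense: "\<And>u \<epsilon>. u \<in> op_dom A \<Longrightarrow> 0 \<le> u \<Longrightarrow> 0 < \<epsilon> \<Longrightarrow>
      \<exists>v \<in> op_dom A \<inter> op_dom K. 0 \<le> v \<and> graph_norm A (u - v) < \<epsilon>"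
  shows "honest A\<^sub>K B V\<^sub>K"
proof -
  interpret P: kato_perturbation A B V
    using assms by unfold_locales
  interpret Q: kato_perturbation A\<^sub>K B V\<^sub>K
    using assms by unfold_locales
  have one: "0 < (1::real)" by simp
  have core: "Q.BR 1 (v - op_app A v) \<le> P.BR 1 (v - op_app A v)"
    if v: "v \<in> op_dom A" "v \<in> op_dom K" "0 \<le> v" for v
  proof -
    have dom: "v \<in> op_dom A\<^sub>K" and app: "op_app A\<^sub>K v = op_app A v - op_app K v"
      using assms(6) v(1,2) by (auto simp: op_extends_def op_minus_def)
    let ?y = "resolvent 1 A\<^sub>K (op_app K v)"
    have y: "?y \<in> op_dom A\<^sub>K" "0 \<le> ?y"
      using assms(5) v by (auto simp: positive_op_def Q.A.resolvent_dom Q.A.resolvent_nonneg)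
    have eq: "v - op_app A v = (1 *\<^sub>R v - op_app A\<^sub>K v) - op_app K v" by (simp add: app)
    have "resolvent 1 A\<^sub>K (v - op_app A v) = resolvent 1 A\<^sub>K (1 *\<^sub>R v - op_app A\<^sub>K v) - ?y"
      unfolding eq by (rule linear_diff[OF Q.A.resolvent_linear[OF one]])
    then have "resolvent 1 A\<^sub>K (v - op_app A v) = v - ?y"
      unfolding Q.A.resolvent_left[OF one dom] .
    moreover have "resolvent 1 A (v - op_app A v) = v"
      using P.A.resolvent_left[OF one v(1)] by simp
    ultimately show ?thesis
      using Q.B_nonneg[OF y] by (simp add: P.BR_def Q.BR_def Q.B_diff dom y)
  qed
  have le: "Q.BR 1 f \<le> P.BR 1 f" if f: "0 \<le> f" for f
  proof -
    define u where "u = resolvent 1 A f"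
    have u: "u \<in> op_dom A" "0 \<le> u" "u - op_app A u = f"
      using P.A.resolvent_right[of 1 f] by (simp_all add: u_def P.A.resolvent_dom P.A.resolvent_nonneg f)
    have "\<forall>n. \<exists>v. v \<in> op_dom A \<and> v \<in> op_dom K \<and> 0 \<le> v \<and> graph_norm A (u - v) < inverse (real (Suc n))"
      using dense[OF u(1,2)] by (metis IntE inverse_positive_iff_positive of_nat_0_less_iff zero_less_Suc)
    then obtain v where v: "\<And>n. v n \<in> op_dom A" "\<And>n. v n \<in> op_dom K" "\<And>n. 0 \<le> v n"
      "\<And>n. graph_norm A (u - v n) < inverse (real (Suc n))" by metis
    have lim: "(\<lambda>n. v n - op_app A (v n)) \<longlonglongrightarrow> f"
    proof (rule LIM_zero_cancel, rule Lim_null_comparison)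
      show "(\<lambda>n. inverse (real (Suc n))) \<longlonglongrightarrow> 0" by (rule LIMSEQ_inverse_real_of_nat)
      have "norm (v n - op_app A (v n) - f) \<le> inverse (real (Suc n))" for n
      proof -
        have eq: "v n - op_app A (v n) - f = op_app A (u - v n) - (u - v n)"
          using u v(1) by (simp add: P.A.app_diff algebra_simps flip: u(3))
        show ?thesis
          unfolding eq using norm_triangle_ineq4[of "op_app A (u - v n)" "u - v n"] v(4)[of n]
          by (simp add: graph_norm_def)
      qed
      then show "\<forall>\<^sub>F n in sequentially. norm (v n - op_app A (v n) - f) \<le> inverse (real (Suc n))"
        by simp
    qed
    show ?thesis
      by (rule cone_limit_le[OF bounded_linear.tendsto[OF Q.bounded_linear_BR[OF one] lim]
            bounded_linear.tendsto[OF P.bounded_linear_BR[OF one] lim]])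
        (simp add: core v)
  qed
  have power_le: "(Q.BR 1 ^^ n) u \<le> (P.BR 1 ^^ n) u" if u: "0 \<le> u" for n u
  proof (induction n)
    case (Suc n)
    have "0 \<le> P.BR 1 ((P.BR 1 ^^ n) u - (Q.BR 1 ^^ n) u)"
      using Suc by (intro P.BR_nonneg) auto
    then have "P.BR 1 ((Q.BR 1 ^^ n) u) \<le> P.BR 1 ((P.BR 1 ^^ n) u)"
      by (simp add: linear_diff[OF P.BR_linear[OF one]])
    then show ?case using le[OF Q.BR_power_nonneg[OF one u, of n]] by simp
  qed simp
  have "(\<lambda>n. (Q.BR 1 ^^ n) u) \<longlonglongrightarrow> 0" if u: "0 \<le> u" for u
  proof (rule Lim_null_comparison)
    show "(\<lambda>n. norm ((P.BR 1 ^^ n) u)) \<longlonglongrightarrow> 0"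
      using P.honest_iff[OF one] assms(3) u by (simp add: tendsto_norm_zero)
    show "\<forall>\<^sub>F n in sequentially. norm ((Q.BR 1 ^^ n) u) \<le> norm ((P.BR 1 ^^ n) u)"
      using power_le[OF u] Q.BR_power_nonneg[OF one u] by (simp add: norm_mono_cone)
  qed
  then show ?thesis using Q.honest_iff[OF one] by blast
qed

end
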